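(* Let $k$ be a field, $B=B_{n,m}$ a bipath poset with $n,m>0$, and $V$ a bipath persistence module over $B$. Let $Y,W',W'',Z',Z''$ be the bipath persistence modules constructed from $V$ as in the context, regarded as submodules of $V$. Then they give a decomposition $$V=V_B\oplus V_{\mathbb L}\oplus V_{\mathbb R}\oplus V_{\mathbb U}\oplus V_{\mathbb D}=Y\oplus W'\oplus W''\oplus Z'\oplus Z''$$ (an internal direct sum of submodules in $\mathrm{rep}_k(B)$) with $V_B=Y$, $V_{\mathbb L}=W'$, $V_{\mathbb R}=W''$, $V_{\mathbb U}=Z'$, $V_{\mathbb D}=Z''$. Here $V_B$ is isomorphic to a direct sum of copies of $k_B$ and, for each $\mathbb X\in\{\mathbb L,\mathbb R,\mathbb U,\mathbb D\}$, $V_{\mathbb X}$ is isomorphic to a direct sum of interval modules $k_J$ with $J\in\mathbb X(B)$.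
   Context: **Basic notions.** A $B$-persistence module is a functor from the poset $B$ (viewed as a category) to finite-dimensional $k$-vector spaces; the category of these is $\mathrm{rep}_k(B)$. The bipath poset $B=B_{n,m}$ is the union of two chains $U:\hat0<1<\dots<n<\hat1$ and $D:\hat0<1'<\dots<m'<\hat1$ sharing only the global minimum $\hat0$ and the global maximum $\hat1$, with elements of $\{1,\dots,n\}$ and $\{1',\dots,m'\}$ pairwise incomparable. A bipath persistence module is a $B$-persistence module. For an interval (convex, connected subset) $J$ of $B$, $k_J$ is the module with $k$ on $J$, $0$ elsewhere, and identity maps between copies of $k$. Sets of intervals of $B$ (where $[a,b]$ is the interval in the chain $U$ or $D$): - $\mathbb L(B)$: the sets $[\hat0,t]\cup[\hat0,s]$ with $t\in U$, $s\in D$, $s,t\ne\hat1$. - $\mathbb R(B)$: the sets $[s,\hat1]\cup[t,\hat1]$ with $s\in U$, $t\in D$, $s,t\neq\hat0$. - $\mathbb U(B)$: the sets $[s,t]$ with $s\le t$ in $U\setminus\{\hat0,\hat1\}$. - $\mathbb D(B)$: the sets $[t,s]$ with $t\le s$ in $D\setminus\{\hat0,\hat1\}$. **Construction.** (1) Let $N=\operatorname{Im}V(\hat0\le\hat1)\subseteq V(\hat1)$ and choose a linear map $\iota:N\to V(\hat0)$ with $V(\hat0\le\hat1)\circ\iota=1_N$. Let $Y\subseteq V$ be the submodule $Y(a)=V(\hat0\le a)(\iota(N))$ (so $Y=0$ if $V(\hat0\le\hat1)=0$). The submodule $Y$ admits a complement in $\mathrm{rep}_k(B)$; let $W$ be a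 submodule of $V$ with $V=Y\oplus W$. It satisfies $W(\hat0\le\hat1)=0$. (2) Let $W'\subseteq W$ be the submodule $W'(a)=W(\hat0\le a)(W(\hat0))$. It admits a complement in $\mathrm{rep}_k(B)$; let $X$ be a submodule of $W$ with $W=W'\oplus X$. It satisfies $X(\hat0)=0$. (3) Dually, let $Z\subseteq X$ be the submodule $Z(a)=\operatorname{Ker}X(a\le\hat1)$. It admits a complement in $\mathrm{rep}_k(B)$; let $W''$ be a submodule of $X$ with $X=W''\oplus Z$. It holds that $Z(\hat0)=Z(\hat1)=0$. (4) Let $Z'$ and $Z''$ be the restrictions of $Z$ to the upper path $U$ and to the lower path $D$, respectively, extended by zero to $B$. *)

theory Defs
  imports Complex_Main "HOL-Library.Function_Algebras"
begin

section \<open>Bipath posets\<close>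

text \<open>The type below carries the order of the bipath poset with two infinite paths; the poset
  $B_{n,m}$ is its finite subset \<open>bipath_poset n m\<close> with the induced order.
  \<open>Bot\<close> and \<open>Top\<close> are $\hat 0$ and $\hat 1$, \<open>Up i\<close> is $i$ and \<open>Dn i\<close> is $i'$.\<close>

datatype bipath = Bot | Up nat | Dn nat | Top

instantiation bipath :: order
begin

fun less_eq_bipath :: "bipath \<Rightarrow> bipath \<Rightarrow> bool" where
  "less_eq_bipath Bot _ = True"
| "less_eq_bipath _ Top = True"
| "less_eq_bipath (Up i) (Up j) = (i \<le> j)"
| "less_eq_bipath (Dn i) (Dn j) = (i \<le> j)"
| "less_eq_bipath _ _ = False"

definition less_bipath :: "bipath \<Rightarrow> bipath \<Rightarrow> bool" where
  "less_bipath x y \<longleftrightarrow> x \<le> y \<and> \<not> y \<le> x"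

instance
proof
  fix x y z :: bipath
  show "x < y \<longleftrightarrow> x \<le> y \<and> \<not> y \<le> x" by (simp add: less_bipath_def)
  show "x \<le> x" by (cases x) simp_all
  show "x \<le> y \<Longrightarrow> y \<le> z \<Longrightarrow> x \<le> z" by (cases x; cases y; cases z) simp_all
  show "x \<le> y \<Longrightarrow> y \<le> x \<Longrightarrow> x = y" by (cases x; cases y) simp_all
qed

end

definition upper_path :: "nat \<Rightarrow> bipath set" where
  "upper_path n = {Bot, Top} \<union> Up ` {1..n}"

definition lower_path :: "nat \<Rightarrow> bipath set" where
  "lower_path m = {Bot, Top} \<union> Dn ` {1..m}"

definition bipath_poset :: "nat \<Rightarrow> nat \<Rightarrow> bipath set" where
  "bipath_poset n m = upper_path n \<union> lower_path m"

definition chain_interval :: "'b::order set \<Rightarrow> 'b \<Rightarrow> 'b \<Rightarrow> 'b set" where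
  "chain_interval C a b = {x \<in> C. a \<le> x \<and> x \<le> b}"

definition L_intervals :: "nat \<Rightarrow> nat \<Rightarrow> bipath set set" where
  "L_intervals n m =
     {chain_interval (upper_path n) Bot t \<union> chain_interval (lower_path m) Bot s | t s.
        t \<in> upper_path n \<and> s \<in> lower_path m \<and> t \<noteq> Top \<and> s \<noteq> Top}"

definition R_intervals :: "nat \<Rightarrow> nat \<Rightarrow> bipath set set" where
  "R_intervals n m =
     {chain_interval (upper_path n) s Top \<union> chain_interval (lower_path m) t Top | s t.
        s \<in> upper_path n \<and> t \<in> lower_path m \<and> s \<noteq> Bot \<and> t \<noteq> Bot}"

definition U_intervals :: "nat \<Rightarrow> bipath set set" where
  "U_intervals n =
     {chain_interval (upper_path n) s t | s t.
        s \<in> upper_path n - {Bot, Top} \<and> t \<in> upper_path n - {Bot, Top} \<and> s \<le> t}"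

definition D_intervals :: "nat \<Rightarrow> bipath set set" where
  "D_intervals m =
     {chain_interval (lower_path m) t s | t s.
        t \<in> lower_path m - {Bot, Top} \<and> s \<in> lower_path m - {Bot, Top} \<and> t \<le> s}"


section \<open>Persistence modules over a poset\<close>

text \<open>The vector spaces of a module are subspaces of one ambient vector space, given by its scalar
  multiplication \<open>scale\<close> on the type \<^typ>\<open>'v\<close>. This is no restriction, as any family of vector
  spaces embeds into its direct sum. \<open>Tr M a b\<close> is meaningful only for \<open>a \<le> b\<close> in the poset
  and only on the elements of \<open>Sp M a\<close>; likewise \<open>Sp M a\<close> only for \<open>a\<close> in the poset.\<close>

record ('b, 'v) pmod =
  Sp :: "'b \<Rightarrow> 'v set"
  Tr :: "'b \<Rightarrow> 'b \<Rightarrow> 'v \<Rightarrow> 'v"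

definition lin_map ::
  "('k::field \<Rightarrow> 'v::ab_group_add \<Rightarrow> 'v) \<Rightarrow> ('k \<Rightarrow> 'w::ab_group_add \<Rightarrow> 'w) \<Rightarrow>
   'v set \<Rightarrow> 'w set \<Rightarrow> ('v \<Rightarrow> 'w) \<Rightarrow> bool" where
  "lin_map scale1 scale2 S T f \<longleftrightarrow>
     (\<forall>x\<in>S. f x \<in> T) \<and>
     (\<forall>x\<in>S. \<forall>y\<in>S. f (x + y) = f x + f y) \<and>
     (\<forall>c. \<forall>x\<in>S. f (scale1 c x) = scale2 c (f x))"

definition pers_module ::
  "('k::field \<Rightarrow> 'v::ab_group_add \<Rightarrow> 'v) \<Rightarrow> 'b::order set \<Rightarrow> ('b, 'v) pmod \<Rightarrow> bool" where
  "pers_module scale P M \<longleftrightarrow>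
     (\<forall>a\<in>P. \<exists>S. finite S \<and> Sp M a = module.span scale S) \<and>
     (\<forall>a\<in>P. \<forall>b\<in>P. a \<le> b \<longrightarrow> lin_map scale scale (Sp M a) (Sp M b) (Tr M a b)) \<and>
     (\<forall>a\<in>P. \<forall>x\<in>Sp M a. Tr M a a x = x) \<and>
     (\<forall>a\<in>P. \<forall>b\<in>P. \<forall>c\<in>P. a \<le> b \<and> b \<le> c \<longrightarrow>
        (\<forall>x\<in>Sp M a. Tr M b c (Tr M a b x) = Tr M a c x))"

definition pers_submodule ::
  "('k::field \<Rightarrow> 'v::ab_group_add \<Rightarrow> 'v) \<Rightarrow> 'b::order set \<Rightarrow>
   ('b, 'v) pmod \<Rightarrow> ('b, 'v) pmod \<Rightarrow> bool" where
  "pers_submodule scale P M V \<longleftrightarrow>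
     pers_module scale P M \<and>
     (\<forall>a\<in>P. Sp M a \<subseteq> Sp V a) \<and>
     (\<forall>a\<in>P. \<forall>b\<in>P. a \<le> b \<longrightarrow> (\<forall>x\<in>Sp M a. Tr M a b x = Tr V a b x))"

definition internal_direct_sum ::
  "('k::field \<Rightarrow> 'v::ab_group_add \<Rightarrow> 'v) \<Rightarrow> 'b::order set \<Rightarrow>
   ('b, 'v) pmod \<Rightarrow> ('b, 'v) pmod list \<Rightarrow> bool" where
  "internal_direct_sum scale P V Ms \<longleftrightarrow>
     (\<forall>M\<in>set Ms. pers_submodule scale P M V) \<and>
     (\<forall>a\<in>P. \<forall>v\<in>Sp V a.
        \<exists>!xs. length xs = length Ms \<and> (\<forall>i<length Ms. xs ! i \<in> Sp (Ms ! i) a) \<and> v = sum_list xs)"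

definition pers_isomorphic ::
  "('k::field \<Rightarrow> 'v::ab_group_add \<Rightarrow> 'v) \<Rightarrow> ('k \<Rightarrow> 'w::ab_group_add \<Rightarrow> 'w) \<Rightarrow> 'b::order set \<Rightarrow>
   ('b, 'v) pmod \<Rightarrow> ('b, 'w) pmod \<Rightarrow> bool" where
  "pers_isomorphic scale1 scale2 P M N \<longleftrightarrow>
     (\<exists>\<phi>. (\<forall>a\<in>P. lin_map scale1 scale2 (Sp M a) (Sp N a) (\<phi> a) \<and>
                  bij_betw (\<phi> a) (Sp M a) (Sp N a)) \<and>
          (\<forall>a\<in>P. \<forall>b\<in>P. a \<le> b \<longrightarrow> (\<forall>x\<in>Sp M a. \<phi> b (Tr M a b x) = Tr N a b (\<phi> a x))))"

definition interval_module :: "'b set \<Rightarrow> ('b, 'k::field) pmod" where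
  "interval_module J =
     \<lparr>Sp = (\<lambda>a. if a \<in> J then UNIV else {0}),
      Tr = (\<lambda>a b x. if a \<in> J \<and> b \<in> J then x else 0)\<rparr>"

text \<open>The external direct sum of a finite family, inside the space of functions on the index type
  with pointwise scalar multiplication \<open>fun_scale scale\<close>.\<close>

definition fun_scale :: "('k \<Rightarrow> 'v \<Rightarrow> 'v) \<Rightarrow> 'k \<Rightarrow> ('i \<Rightarrow> 'v) \<Rightarrow> ('i \<Rightarrow> 'v)" where
  "fun_scale scale c f = (\<lambda>i. scale c (f i))"

definition direct_sum :: "'i set \<Rightarrow> ('i \<Rightarrow> ('b, 'v::ab_group_add) pmod) \<Rightarrow> ('b, 'i \<Rightarrow> 'v) pmod" where
  "direct_sum I M =
     \<lparr>Sp = (\<lambda>a. {f. (\<forall>i\<in>I. f i \<in> Sp (M i) a) \<and> (\<forall>i. i \<notin> I \<longrightarrow> f i = 0)}),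
      Tr = (\<lambda>a b f i. if i \<in> I then Tr (M i) a b (f i) else 0)\<rparr>"

text \<open>Since the modules are finite-dimensional and the poset is finite, only finite direct sums
  occur; the empty sum is the zero module.\<close>

definition sum_of_interval_modules ::
  "('k::field \<Rightarrow> 'v::ab_group_add \<Rightarrow> 'v) \<Rightarrow> 'b::order set \<Rightarrow> 'b set set \<Rightarrow> ('b, 'v) pmod \<Rightarrow> bool" where
  "sum_of_interval_modules scale P \<J> M \<longleftrightarrow>
     (\<exists>(I::nat set) J. finite I \<and> (\<forall>i\<in>I. J i \<in> \<J>) \<and>
        pers_isomorphic scale (fun_scale (*)) P M (direct_sum I (\<lambda>i. interval_module (J i))))"

definition extend_by_zero :: "'b set \<Rightarrow> ('b, 'v::ab_group_add) pmod \<Rightarrow> ('b, 'v) pmod" where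
  "extend_by_zero C M =
     \<lparr>Sp = (\<lambda>a. if a \<in> C then Sp M a else {0}),
      Tr = (\<lambda>a b x. if a \<in> C \<and> b \<in> C then Tr M a b x else 0)\<rparr>"


section \<open>The construction\<close>

text \<open>A record update \<open>V\<lparr>Sp := S\<rparr>\<close> is the submodule of \<open>V\<close> with spaces \<open>S\<close>: it keeps the structure
  maps of \<open>V\<close>, which by \<^const>\<open>pers_module\<close> matter only on \<open>S\<close>. The choices made in the construction
  are \<open>\<iota>\<close>, \<open>W\<close>, \<open>X\<close> and \<open>W''\<close>.\<close>

definition bipath_construction ::
  "('k::field \<Rightarrow> 'v::ab_group_add \<Rightarrow> 'v) \<Rightarrow> nat \<Rightarrow> nat \<Rightarrow> (bipath, 'v) pmod \<Rightarrow> ('v \<Rightarrow> 'v) \<Rightarrow>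
   (bipath, 'v) pmod \<Rightarrow> (bipath, 'v) pmod \<Rightarrow> (bipath, 'v) pmod \<Rightarrow> (bipath, 'v) pmod \<Rightarrow>
   (bipath, 'v) pmod \<Rightarrow> (bipath, 'v) pmod \<Rightarrow> (bipath, 'v) pmod \<Rightarrow> (bipath, 'v) pmod \<Rightarrow> bool" where
  "bipath_construction scale n m V \<iota> Y W W' X W'' Z Z' Z'' \<longleftrightarrow>
     (let B = bipath_poset n m; N = Tr V Bot Top ` Sp V Bot in
       lin_map scale scale N (Sp V Bot) \<iota> \<and>
       (\<forall>x\<in>N. Tr V Bot Top (\<iota> x) = x) \<and>
       Y = V\<lparr>Sp := (\<lambda>a. Tr V Bot a ` \<iota> ` N)\<rparr> \<and>
       internal_direct_sum scale B V [Y, W] \<and>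
       W' = W\<lparr>Sp := (\<lambda>a. Tr W Bot a ` Sp W Bot)\<rparr> \<and>
       internal_direct_sum scale B W [W', X] \<and>
       Z = X\<lparr>Sp := (\<lambda>a. {x \<in> Sp X a. Tr X a Top x = 0})\<rparr> \<and>
       internal_direct_sum scale B X [W'', Z] \<and>
       Z' = extend_by_zero (upper_path n) Z \<and>
       Z'' = extend_by_zero (lower_path m) Z)"

end

theory Submission
  imports Defs
begin

text \<open>The construction peels off one summand at a time, and each step splits for an elementary reason.

The module \<open>Y\<close> maps isomorphically onto the image \<open>N\<close> of $V(\hat 0 \le \hat 1)$. If \<open>C\<close> is a complement of
\<open>N\<close> in $V(\hat 1)$, then the preimages of \<open>C\<close> in the spaces \<open>V a\<close> form a complement of \<open>Y\<close>; as the
structure maps of \<open>Y\<close> out of $\hat 0$ are injective, every basis of $Y(\hat 0)$ spreads to a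
decomposition of \<open>Y\<close> into copies of $k_B$. For any complement \<open>W\<close>, the image of $W(\hat 0 \le \hat 1)$ lies in
$Y(\hat 1) \cap W(\hat 1) = 0$.

The submodule \<open>W'\<close> has surjective structure maps, and along a finite chain such a submodule always
has a complement: choose it from the end of the chain backwards, inside the preimage of what is
already chosen (\<open>chain_complement_of_surjective\<close>). Dually, \<open>Z\<close> contains every vector that some
structure map sends into \<open>Z\<close>, and for such a submodule a complement can be chosen from the start
of the chain forwards (\<open>chain_complement_of_saturated\<close>). In both cases the complement is forced at
$\hat 0$ and $\hat 1$, so the choices along the two paths fit together (\<open>bipath_complement\<close>).

The decomposition of the summands into interval modules is recorded by a barcode basis: finitely
many sections \<open>g\<close> of the module, sent to each other by the structure maps as long as they do not
vanish, whose nonzero values at every point form a basis. The supports of the sections are then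
the intervals. The module \<open>W'\<close> is generated by its space at $\hat 0$ and so is determined by
the kernels of the structure maps out of $\hat 0$. These kernels form two chains of subspaces, one for each
path, and the decisive fact is that two chains of subspaces always admit a common adapted
basis (\<open>basis_adapted_to_two_chains\<close>). Spreading such a basis from $\hat 0$ gives a barcode basis of
\<open>W'\<close>, whose supports are closed downwards. In the same way, \<open>W''\<close> embeds into the constant module on
$W''(\hat 1)$ and is determined by two chains of images there, and a basis adapted to them gives
supports that are closed upwards.

Finally, \<open>Z\<close> vanishes at $\hat 0$ and $\hat 1$, hence is the sum of two modules, each supported on a chain. A
module supported on a finite chain is decomposed by induction: split off the submodule generated by
the space at the least element, by the complement along a chain, and decompose it by a
basis adapted to a single chain of kernels (\<open>barcode_basis_of_chain_supported\<close>).\<close>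

section \<open>Finite chains\<close>

lemma finite_chain_induct_max [consumes 2, case_names empty insert]:
  fixes C :: "'a::order set"
  assumes "finite C" and "\<forall>x\<in>C. \<forall>y\<in>C. x \<le> y \<or> y \<le> x"
    and empty: "P {}"
    and insert: "\<And>C t. finite C \<Longrightarrow> \<forall>x\<in>C. \<forall>y\<in>C. x \<le> y \<or> y \<le> x \<Longrightarrow> \<forall>x\<in>C. x < t \<Longrightarrow> P C
      \<Longrightarrow> P (insert t C)"
  shows "P C"
  using assms(1,2)
proof (induction C rule: finite_psubset_induct)
  case (psubset C)
  show ?case
  proof (cases "C = {}")
    case False
    then obtain t where t: "t \<in> C" "\<forall>x\<in>C. t \<le> x \<longrightarrow> t = x"
      using finite_has_maximal[OF psubset.hyps] by blast
    then have "\<forall>x\<in>C - {t}. x < t"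
      using psubset.prems by (metis DiffD1 DiffD2 insertI1 order_le_less)
    moreover have "P (C - {t})"
      using t psubset.IH psubset.prems by (metis DiffD1 Diff_subset psubsetI insert_Diff insertI1 DiffE)
    ultimately have "P (insert t (C - {t}))"
      using psubset by (intro insert) auto
    then show ?thesis
      using t(1) by (simp add: insert_absorb)
  qed (use empty in simp)
qed

lemma finite_chain_induct_min [consumes 2, case_names empty insert]:
  fixes C :: "'a::order set"
  assumes "finite C" and "\<forall>x\<in>C. \<forall>y\<in>C. x \<le> y \<or> y \<le> x"
    and empty: "P {}"
    and insert: "\<And>C p. finite C \<Longrightarrow> \<forall>x\<in>C. \<forall>y\<in>C. x \<le> y \<or> y \<le> x \<Longrightarrow> \<forall>x\<in>C. p < x \<Longrightarrow> P C
      \<Longrightarrow> P (insert p C)"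
  shows "P C"
  using assms(1,2)
proof (induction C rule: finite_psubset_induct)
  case (psubset C)
  show ?case
  proof (cases "C = {}")
    case False
    then obtain p where p: "p \<in> C" "\<forall>x\<in>C. x \<le> p \<longrightarrow> p = x"
      using finite_has_minimal[OF psubset.hyps] by blast
    then have "\<forall>x\<in>C - {p}. p < x"
      using psubset.prems by (metis DiffD1 DiffD2 insertI1 order_le_less)
    moreover have "P (C - {p})"
      using p psubset.IH psubset.prems by (metis DiffD1 Diff_subset psubsetI insert_Diff insertI1 DiffE)
    ultimately have "P (insert p (C - {p}))"
      using psubset by (intro insert) auto
    then show ?thesis
      using p(1) by (simp add: insert_absorb)
  qed (use empty in simp)
qed

lemma finite_chain_has_greatest:
  fixes C :: "'a::order set"
  assumes "finite C" "C \<noteq> {}" "\<forall>x\<in>C. \<forall>y\<in>C. x \<le> y \<or> y \<le> x"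
  obtains t where "t \<in> C" "\<forall>x\<in>C. x \<le> t"
  using finite_has_maximal[OF assms(1,2)] assms(3) by metis

lemma finite_chain_has_least:
  fixes C :: "'a::order set"
  assumes "finite C" "C \<noteq> {}" "\<forall>x\<in>C. \<forall>y\<in>C. x \<le> y \<or> y \<le> x"
  obtains t where "t \<in> C" "\<forall>x\<in>C. t \<le> x"
  using finite_has_minimal[OF assms(1,2)] assms(3) by metis

lemma chain_interval_if_down_closed:
  fixes C :: "'a::order set"
  assumes "finite C" "\<forall>x\<in>C. \<forall>y\<in>C. x \<le> y \<or> y \<le> x" and D: "D \<subseteq> C" "D \<noteq> {}"
    and "\<And>x y. x \<in> C \<Longrightarrow> y \<in> D \<Longrightarrow> x \<le> y \<Longrightarrow> x \<in> D" and "\<And>x. x \<in> C \<Longrightarrow> p \<le> x"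
  obtains t where "t \<in> D" "D = chain_interval C p t"
proof -
  have "finite D" "\<forall>x\<in>D. \<forall>y\<in>D. x \<le> y \<or> y \<le> x"
    using assms(1,2) D(1) finite_subset by blast+
  then obtain t where "t \<in> D" "\<forall>x\<in>D. x \<le> t"
    using finite_chain_has_greatest[OF _ D(2)] by blast
  then have "D = chain_interval C p t"
    using assms(5,6) D(1) unfolding chain_interval_def by blast
  then show thesis using that \<open>t \<in> D\<close> by blast
qed

lemma chain_interval_if_up_closed:
  fixes C :: "'a::order set"
  assumes "finite C" "\<forall>x\<in>C. \<forall>y\<in>C. x \<le> y \<or> y \<le> x" and D: "D \<subseteq> C" "D \<noteq> {}"
    and "\<And>x y. x \<in> C \<Longrightarrow> y \<in> D \<Longrightarrow> y \<le> x \<Longrightarrow> x \<in> D" and "\<And>x. x \<in> C \<Longrightarrow> x \<le> q"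
  obtains s where "s \<in> D" "D = chain_interval C s q"
proof -
  have "finite D" "\<forall>x\<in>D. \<forall>y\<in>D. x \<le> y \<or> y \<le> x"
    using assms(1,2) D(1) finite_subset by blast+
  then obtain s where "s \<in> D" "\<forall>x\<in>D. s \<le> x"
    using finite_chain_has_least[OF _ D(2)] by blast
  then have "D = chain_interval C s q"
    using assms(5,6) D(1) unfolding chain_interval_def by blast
  then show thesis using that \<open>s \<in> D\<close> by blast
qed

lemma chain_of_monotone_images:
  fixes f :: "'a::order \<Rightarrow> 'c::order"
  assumes "\<forall>x\<in>C. \<forall>y\<in>C. x \<le> y \<or> y \<le> x" "\<And>x y. x \<in> C \<Longrightarrow> y \<in> C \<Longrightarrow> x \<le> y \<Longrightarrow> f x \<le> f y"
  shows "\<forall>F\<in>f ` C. \<forall>H\<in>f ` C. F \<le> H \<or> H \<le> F"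
  using assms by blast

section \<open>Subspaces\<close>

text \<open>A copy of \<^locale>\<open>vector_space\<close>, so that the notions below are not also instantiated for real
vector spaces through the interpretation of that locale.\<close>
locale ambient_space = vector_space scale for scale :: "'k::field \<Rightarrow> 'v::ab_group_add \<Rightarrow> 'v"
begin

notation scale (infixr "*s" 75)

definition direct_decomp :: "'v set \<Rightarrow> 'v set \<Rightarrow> 'v set \<Rightarrow> bool" where
  "direct_decomp E A C \<longleftrightarrow>
     subspace A \<and> subspace C \<and> A \<inter> C = {0} \<and> E = {x + y | x y. x \<in> A \<and> y \<in> C}"

lemma direct_decompD:
  assumes "direct_decomp E A C"
  shows "subspace A" "subspace C" "subspace E" "A \<subseteq> E" "C \<subseteq> E"
    "\<And>x. x \<in> A \<Longrightarrow> x \<in> C \<Longrightarrow> x = 0"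
    "\<And>v. v \<in> E \<Longrightarrow> \<exists>x\<in>A. \<exists>y\<in>C. v = x + y"
proof -
  have A: "subspace A" "subspace C" "A \<inter> C = {0}" and E: "E = {x + y | x y. x \<in> A \<and> y \<in> C}"
    using assms by (auto simp: direct_decomp_def)
  show "subspace A" "subspace C" by fact+
  show "subspace E" unfolding E by (rule subspace_sums) fact+
  show "A \<subseteq> E" unfolding E using subspace_0[OF A(2)] by force
  show "C \<subseteq> E" unfolding E using subspace_0[OF A(1)] by force
  show "\<And>x. x \<in> A \<Longrightarrow> x \<in> C \<Longrightarrow> x = 0" using A(3) by blast
  show "\<And>v. v \<in> E \<Longrightarrow> \<exists>x\<in>A. \<exists>y\<in>C. v = x + y" unfolding E by blast
qed

lemma direct_decompI:
  assumes "subspace A" "subspace C" "subspace E" "A \<subseteq> E" "C \<subseteq> E"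
    and "\<And>x. x \<in> A \<Longrightarrow> x \<in> C \<Longrightarrow> x = 0"
    and "\<And>v. v \<in> E \<Longrightarrow> \<exists>x\<in>A. \<exists>y\<in>C. v = x + y"
  shows "direct_decomp E A C"
proof -
  have "x + y \<in> E" if "x \<in> A" "y \<in> C" for x y
    using that assms(3,4,5) subspace_add by blast
  then have "E = {x + y | x y. x \<in> A \<and> y \<in> C}"
    using assms(7) by blast
  moreover have "A \<inter> C = {0}"
    using assms(6) subspace_0[OF assms(1)] subspace_0[OF assms(2)] by blast
  ultimately show ?thesis
    using assms(1,2) by (simp add: direct_decomp_def)
qed

lemma direct_decomp_self: "direct_decomp E E C \<Longrightarrow> C = {0}"
  using direct_decompD[of E E C] subspace_0[of C] by blast

lemma direct_decomp_zero: "direct_decomp E {0} C \<Longrightarrow> C = E"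
  using direct_decompD(5,7)[of E "{0}" C] by fastforce

lemma direct_decomp_commute: "direct_decomp E A C \<Longrightarrow> direct_decomp E C A"
  unfolding direct_decomp_def by (auto simp: Int_commute) (use add.commute in blast)+

text \<open>Extend a basis of \<open>A\<close> first by vectors of \<open>D\<close> and then by vectors of \<open>E\<close>; the vectors added span the
complement. They generate all of \<open>D\<close> because the component in \<open>A\<close> of a vector of \<open>D\<close> lies in \<open>D\<close> as well.\<close>
lemma complement_above:
  assumes "subspace E" "subspace A" "subspace D" "A \<subseteq> E" "D \<subseteq> E"
    and AD: "\<And>x. x \<in> A \<Longrightarrow> x \<in> D \<Longrightarrow> x = 0"
  obtains C where "D \<subseteq> C" "direct_decomp E A C"
proof -
  obtain TA where TA: "TA \<subseteq> A" "independent TA" "A \<subseteq> span TA"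
    using maximal_independent_subset by blast
  obtain T1 where T1: "TA \<subseteq> T1" "T1 \<subseteq> TA \<union> D" "independent T1" "TA \<union> D \<subseteq> span T1"
    using maximal_independent_subset_extend[of TA "TA \<union> D"] TA by auto
  have "T1 \<subseteq> E" using T1(2) TA(1) assms(4,5) by blast
  then obtain T where T: "T1 \<subseteq> T" "T \<subseteq> E" "independent T" "E \<subseteq> span T"
    using maximal_independent_subset_extend T1(3) by blast
  have spTA: "span TA = A"
    using TA assms(2) span_subspace by blast
  have split: "span T' = {x + y | x y. x \<in> A \<and> y \<in> span (T' - TA)}" if "TA \<subseteq> T'" for T'
    using span_Un[of TA "T' - TA"] that spTA by (simp add: Un_absorb1)
  have "D \<subseteq> span (T - TA)"
  proof
    fix d assume d: "d \<in> D"
    then obtain a s where s: "d = a + s" "a \<in> A" "s \<in> span (T1 - TA)"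
      using T1(4) split[OF T1(1)] by auto
    have "s \<in> D"
      using s(3) T1(2) assms(3) span_minimal[of "T1 - TA" D] by blast
    then have "a \<in> D"
      using s(1) d assms(3) subspace_diff[of D d s] by simp
    then have "d = s" using s AD by simp
    then show "d \<in> span (T - TA)"
      using s(3) T(1) span_mono[of "T1 - TA" "T - TA"] by blast
  qed
  moreover have "direct_decomp E A (span (T - TA))"
  proof (rule direct_decompI)
    show "span (T - TA) \<subseteq> E"
      using T(2) assms(1) span_minimal[of "T - TA" E] by blast
    show "x = 0" if "x \<in> A" "x \<in> span (T - TA)" for x
    proof -
      have T_TA: "TA \<subseteq> T" using T1 T by blast
      have x: "x \<in> span TA" "x \<in> span (T - TA)" using that spTA by auto
      have i: "independent TA" "independent (T - TA)" using TA T independent_mono by blast+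
      have "representation T x = representation TA x"
        using representation_extend[OF T(3) x(1) T_TA] .
      moreover have "representation T x = representation (T - TA) x"
        using representation_extend[OF T(3) x(2)] by blast
      ultimately have "representation T x b = 0" for b
        by (metis DiffD2 representation_ne_zero)
      then have "sum (\<lambda>b. representation T x b *s b) {b. representation T x b \<noteq> 0} = 0"
        by simp
      moreover have "x \<in> span T" using x(1) T_TA span_mono by blast
      ultimately show ?thesis
        using sum_nonzero_representation_eq[OF T(3)] by metis
    qed
    show "\<exists>x\<in>A. \<exists>y\<in>span (T - TA). v = x + y" if "v \<in> E" for v
      using that T split[of T] T1 by blast
  qed (use assms in auto)
  ultimately show thesis ..
qed

lemma complement_exists:
  assumes "subspace E" "subspace A" "A \<subseteq> E"
  obtains C where "direct_decomp E A C"
  using complement_above[of E A "{0}"] assms subspace_0[of E] by auto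

text \<open>Enlarge \<open>T\<close> to a basis of \<open>span (T \<union> G)\<close> by vectors of \<open>G\<close>, for the members \<open>G\<close> of the chain in
increasing order.\<close>
lemma extend_basis_along_chain:
  assumes "finite \<G>" "\<forall>G\<in>\<G>. \<forall>H\<in>\<G>. G \<subseteq> H \<or> H \<subseteq> G" "independent T"
  shows "\<exists>T'. T \<subseteq> T' \<and> T' \<subseteq> T \<union> \<Union>\<G> \<and> independent T' \<and> (\<forall>G\<in>\<G>. G \<subseteq> span (T \<union> (T' \<inter> G)))"
  using assms(1,2)
proof (induction \<G> rule: finite_chain_induct_max)
  case empty
  then show ?case using assms(3) by auto
next
  case (insert \<G> H)
  then obtain T' where T': "T \<subseteq> T'" "T' \<subseteq> T \<union> \<Union>\<G>" "independent T'"
    "\<forall>G\<in>\<G>. G \<subseteq> span (T \<union> (T' \<inter> G))" by blast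
  have H: "\<Union>\<G> \<subseteq> H" using insert.hyps(3) by blast
  obtain T'' where T'': "T' \<subseteq> T''" "T'' \<subseteq> T \<union> H" "independent T''" "T \<union> H \<subseteq> span T''"
    using maximal_independent_subset_extend[of T' "T \<union> H"] T'(2,3) H by blast
  have "T'' \<subseteq> T \<union> (T'' \<inter> H)" using T'' by blast
  then have "H \<subseteq> span (T \<union> (T'' \<inter> H))"
    using T''(4) span_mono by blast
  moreover have "G \<subseteq> span (T \<union> (T'' \<inter> G))" if "G \<in> \<G>" for G
  proof -
    have "T \<union> (T' \<inter> G) \<subseteq> T \<union> (T'' \<inter> G)" using T'' by blast
    then show ?thesis using T'(4) that span_mono by blast
  qed
  moreover have "T \<subseteq> T''" "T'' \<subseteq> T \<union> \<Union>(insert H \<G>)" using T'(1) T''(1,2) by auto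
  ultimately show ?case
    using T''(3) by blast
qed

text \<open>Any two flags in a vector space have a common adapted basis, a form of the Bruhat decomposition. Along
the first chain a basis \<open>T\<close> of its current member is enlarged, with the invariant that
\<open>T \<inter> G\<close> spans \<open>span T \<inter> G\<close> for every \<open>G\<close> in the second chain. To pass to the next member \<open>H\<close>, the basis is
extended along the chain of the subspaces \<open>G \<inter> H\<close>.\<close>
lemma basis_adapted_to_two_chains:
  assumes "finite \<F>" "\<forall>F\<in>\<F>. \<forall>H\<in>\<F>. F \<subseteq> H \<or> H \<subseteq> F"
    and "finite \<G>" "\<forall>G\<in>\<G>. \<forall>H\<in>\<G>. G \<subseteq> H \<or> H \<subseteq> G"
    and sub: "\<forall>F\<in>\<F> \<union> \<G>. subspace F \<and> F \<subseteq> E" and E: "E \<in> \<F>" "E \<in> \<G>"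
  obtains T where "independent T" "span T = E" "\<forall>F\<in>\<F> \<union> \<G>. F \<subseteq> span (T \<inter> F)"
proof -
  have "\<exists>T. independent T \<and> T \<subseteq> \<Union>\<F> \<and> (\<forall>F\<in>\<F>. F \<subseteq> span (T \<inter> F)) \<and>
      (\<forall>G\<in>\<G>. span T \<inter> G \<subseteq> span (T \<inter> G))"
    using assms(1,2) sub
  proof (induction \<F> rule: finite_chain_induct_max)
    case empty
    then show ?case
      by (intro exI[of _ "{}"]) (auto simp: independent_empty)
  next
    case (insert \<F> H)
    then obtain T where T: "independent T" "T \<subseteq> \<Union>\<F>" "\<forall>F\<in>\<F>. F \<subseteq> span (T \<inter> F)"
      "\<forall>G\<in>\<G>. span T \<inter> G \<subseteq> span (T \<inter> G)" by auto
    have H: "subspace H" "H \<subseteq> E" and G: "\<forall>G\<in>\<G>. subspace G \<and> G \<subseteq> E"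
      using insert.prems by auto
    have TH: "T \<subseteq> H" using T(2) insert.hyps(3) by blast
    let ?\<G> = "(\<lambda>G. G \<inter> H) ` \<G>"
    have "\<forall>G\<in>?\<G>. \<forall>K\<in>?\<G>. G \<subseteq> K \<or> K \<subseteq> G"
      using assms(4) by blast
    then obtain T' where T': "T \<subseteq> T'" "T' \<subseteq> T \<union> \<Union>?\<G>" "independent T'"
      "\<forall>G\<in>?\<G>. G \<subseteq> span (T \<union> (T' \<inter> G))"
      using extend_basis_along_chain[of ?\<G> T] assms(3) T(1) by auto
    have T'H: "T' \<subseteq> H" using T'(2) TH by auto
    have "E \<inter> H \<subseteq> span (T \<union> (T' \<inter> (E \<inter> H)))"
      using T'(4) E(2) by blast
    then have "H \<subseteq> span T'"
      using H(2) T'(1) span_mono[of "T \<union> (T' \<inter> (E \<inter> H))" T'] by blast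
    then have 1: "H \<subseteq> span (T' \<inter> H)"
      using T'H by (simp add: Int_absorb2)
    have 2: "F \<subseteq> span (T' \<inter> F)" if "F \<in> \<F>" for F
      using T(3) that T'(1) span_mono[of "T \<inter> F" "T' \<inter> F"] by blast
    have 3: "v \<in> span (T' \<inter> G)" if GG: "G \<in> \<G>" and v: "v \<in> span T'" "v \<in> G" for v G
    proof -
      have "v \<in> G \<inter> H"
        using v T'H H(1) span_minimal by blast
      then have "v \<in> span (T \<union> (T' \<inter> (G \<inter> H)))"
        using T'(4) GG by blast
      then obtain t s where ts: "v = t + s" "t \<in> span T" "s \<in> span (T' \<inter> (G \<inter> H))"
        unfolding span_Un by blast
      have sG: "s \<in> span (T' \<inter> G)"
        using ts(3) span_mono[of "T' \<inter> (G \<inter> H)" "T' \<inter> G"] by blast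
      then have "s \<in> G"
        using G GG span_minimal[of "T' \<inter> G" G] by blast
      \<comment> \<open>The part of \<open>v\<close> outside the new basis vectors again lies in \<open>G\<close>, so the old basis already controls it.\<close>
      then have "t \<in> G"
        using ts(1) v(2) G GG subspace_diff[of G v s] by simp
      then have "t \<in> span (T' \<inter> G)"
        using T(4) GG ts(2) T'(1) span_mono[of "T \<inter> G" "T' \<inter> G"] by blast
      then show ?thesis
        using ts(1) sG span_add by blast
    qed
    show ?case
      using 1 2 3 T'(3) T'H by (intro exI[of _ T']) auto
  qed
  then obtain T where T: "independent T" "T \<subseteq> \<Union>\<F>" "\<forall>F\<in>\<F>. F \<subseteq> span (T \<inter> F)"
    "\<forall>G\<in>\<G>. span T \<inter> G \<subseteq> span (T \<inter> G)" by blast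
  have "T \<subseteq> E" using T(2) sub by blast
  then have "span T = E"
    using T(3) E(1) sub span_mono[of "T \<inter> E" T] span_minimal[of T E] by blast
  moreover have "G \<subseteq> span (T \<inter> G)" if "G \<in> \<G>" for G
    using T(4) that sub \<open>span T = E\<close> by (metis UnI2 inf.absorb2)
  ultimately have "\<forall>F\<in>\<F> \<union> \<G>. F \<subseteq> span (T \<inter> F)"
    using T(3) by auto
  then show thesis
    using that[OF T(1) \<open>span T = E\<close>] by simp
qed

section \<open>Persistence modules and their submodules\<close>

lemma pers_module_space:
  assumes "pers_module scale P M" "a \<in> P"
  shows "subspace (Sp M a)" "\<exists>S. finite S \<and> Sp M a = span S"
  using assms by (auto simp: pers_module_def)

lemma pers_module_map:
  assumes "pers_module scale P M" "a \<in> P" "b \<in> P" "a \<le> b"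
  shows "x \<in> Sp M a \<Longrightarrow> Tr M a b x \<in> Sp M b"
    "x \<in> Sp M a \<Longrightarrow> y \<in> Sp M a \<Longrightarrow> Tr M a b (x + y) = Tr M a b x + Tr M a b y"
    "x \<in> Sp M a \<Longrightarrow> Tr M a b (c *s x) = c *s Tr M a b x"
  using assms by (auto simp: pers_module_def lin_map_def)

lemma pers_module_id: "pers_module scale P M \<Longrightarrow> a \<in> P \<Longrightarrow> x \<in> Sp M a \<Longrightarrow> Tr M a a x = x"
  by (auto simp: pers_module_def)

lemma pers_module_comp:
  assumes "pers_module scale P M" "a \<in> P" "b \<in> P" "c \<in> P" "a \<le> b" "b \<le> c" "x \<in> Sp M a"
  shows "Tr M b c (Tr M a b x) = Tr M a c x"
  using assms by (auto simp: pers_module_def)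

lemma pers_module_map_zero:
  assumes "pers_module scale P M" "a \<in> P" "b \<in> P" "a \<le> b"
  shows "Tr M a b 0 = 0"
  using pers_module_map(3)[OF assms, of 0 0] subspace_0[OF pers_module_space(1)[OF assms(1,2)]] by simp

lemma pers_module_map_diff:
  assumes "pers_module scale P M" "a \<in> P" "b \<in> P" "a \<le> b" "x \<in> Sp M a" "y \<in> Sp M a"
  shows "Tr M a b (x - y) = Tr M a b x - Tr M a b y"
proof -
  have "x - y \<in> Sp M a"
    using assms pers_module_space(1) subspace_diff by blast
  then show ?thesis
    using pers_module_map(2)[OF assms(1-4), of "x - y" y] assms(6) by (simp add: algebra_simps)
qed

lemma pers_module_map_sum:
  assumes "pers_module scale P M" "a \<in> P" "b \<in> P" "a \<le> b" "\<And>i. i \<in> I \<Longrightarrow> x i \<in> Sp M a"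
  shows "Tr M a b (\<Sum>i\<in>I. u i *s x i) = (\<Sum>i\<in>I. u i *s Tr M a b (x i))"
  using assms(5)
proof (induction I rule: infinite_finite_induct)
  case (insert i I)
  have "(\<Sum>i\<in>I. u i *s x i) \<in> Sp M a" "u i *s x i \<in> Sp M a"
    using insert.prems pers_module_space(1)[OF assms(1,2)] by (auto intro!: subspace_sum subspace_scale)
  then show ?case
    using insert pers_module_map[OF assms(1-4)] by auto
qed (use pers_module_map_zero[OF assms(1-4)] in auto)

lemma pers_module_image_subspace:
  assumes "pers_module scale P M" "a \<in> P" "b \<in> P" "a \<le> b" "subspace S" "S \<subseteq> Sp M a"
  shows "subspace (Tr M a b ` S)"
proof (rule subspaceI)
  show "0 \<in> Tr M a b ` S"
    using pers_module_map_zero[OF assms(1-4)] subspace_0[OF assms(5)] by force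
  show "x + y \<in> Tr M a b ` S" if xy: "x \<in> Tr M a b ` S" "y \<in> Tr M a b ` S" for x y
  proof -
    obtain x' y' where "x = Tr M a b x'" "y = Tr M a b y'" "x' \<in> S" "y' \<in> S" using xy by blast
    moreover from this have "x' \<in> Sp M a" "y' \<in> Sp M a" using assms(6) by auto
    ultimately show ?thesis
      using pers_module_map(2)[OF assms(1-4), of x' y'] subspace_add[OF assms(5), of x' y'] by (metis image_eqI)
  qed
  show "c *s x \<in> Tr M a b ` S" if x: "x \<in> Tr M a b ` S" for x c
  proof -
    obtain x' where "x = Tr M a b x'" "x' \<in> S" using x by blast
    moreover from this have "x' \<in> Sp M a" using assms(6) by auto
    ultimately show ?thesis
      using pers_module_map(3)[OF assms(1-4), of x' c] subspace_scale[OF assms(5), of x' c] by (metis image_eqI)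
  qed
qed

lemma pers_module_preimage_subspace:
  assumes "pers_module scale P M" "a \<in> P" "b \<in> P" "a \<le> b" "subspace S"
  shows "subspace {x \<in> Sp M a. Tr M a b x \<in> S}"
  using assms(5) pers_module_map[OF assms(1-4)] pers_module_map_zero[OF assms(1-4)]
    pers_module_space(1)[OF assms(1,2)]
  by (auto intro!: subspaceI simp: subspace_0 subspace_add subspace_scale)

lemma pers_module_kernel_subspace:
  assumes "pers_module scale P M" "a \<in> P" "b \<in> P" "a \<le> b"
  shows "subspace {x \<in> Sp M a. Tr M a b x = 0}"
  using pers_module_preimage_subspace[OF assms, of "{0}"] by simp

lemma pers_module_span_image:
  assumes "pers_module scale P M" "a \<in> P" "b \<in> P" "a \<le> b" "T \<subseteq> Sp M a"
  shows "Tr M a b ` span T = span (Tr M a b ` T)"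
proof
  have sub: "span T \<subseteq> Sp M a"
    using assms pers_module_space(1) span_minimal by blast
  have "subspace (Tr M a b ` span T)"
    using pers_module_image_subspace[OF assms(1-4) _ sub] by simp
  then show "span (Tr M a b ` T) \<subseteq> Tr M a b ` span T"
    by (intro span_minimal image_mono) (auto simp: span_superset)
  have "subspace {x \<in> Sp M a. Tr M a b x \<in> span (Tr M a b ` T)}"
    using pers_module_preimage_subspace[OF assms(1-4)] by simp
  then have "span T \<subseteq> {x \<in> Sp M a. Tr M a b x \<in> span (Tr M a b ` T)}"
    using assms(5) by (intro span_minimal) (auto simp: span_base)
  then show "Tr M a b ` span T \<subseteq> span (Tr M a b ` T)" by auto
qed

lemma finite_dimensional_subspace:
  assumes "subspace A" "A \<subseteq> span S" "finite S"
  shows "\<exists>S'. finite S' \<and> A = span S'"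
proof -
  obtain T where T: "T \<subseteq> A" "independent T" "A \<subseteq> span T"
    using maximal_independent_subset by blast
  then have "finite T"
    using independent_span_bound[OF assms(3), of T] assms(2) by blast
  then show ?thesis
    using T assms(1) span_subspace[of T A] by metis
qed

lemma pers_submodule_update:
  assumes "pers_module scale P M"
    and "\<And>a. a \<in> P \<Longrightarrow> subspace (S a) \<and> S a \<subseteq> Sp M a"
    and "\<And>a b x. a \<in> P \<Longrightarrow> b \<in> P \<Longrightarrow> a \<le> b \<Longrightarrow> x \<in> S a \<Longrightarrow> Tr M a b x \<in> S b"
  shows "pers_submodule scale P (M\<lparr>Sp := S\<rparr>) M"
proof -
  have sub: "x \<in> Sp M a" if "a \<in> P" "x \<in> S a" for a x
    using assms(2) that by blast
  have "\<exists>S'. finite S' \<and> S a = span S'" if "a \<in> P" for a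
    using assms(2)[OF that] pers_module_space(2)[OF assms(1) that] finite_dimensional_subspace by metis
  moreover have "lin_map scale scale (S a) (S b) (Tr M a b)" if "a \<in> P" "b \<in> P" "a \<le> b" for a b
    unfolding lin_map_def
    using assms(3)[OF that] pers_module_map(2,3)[OF assms(1) that] sub[OF that(1)] by metis
  ultimately have "pers_module scale P (M\<lparr>Sp := S\<rparr>)"
    unfolding pers_module_def
    using pers_module_id[OF assms(1)] pers_module_comp[OF assms(1)] sub by simp
  then show ?thesis
    using assms(2) by (simp add: pers_submodule_def)
qed

lemma pers_submoduleD:
  assumes "pers_submodule scale P M V"
  shows "pers_module scale P M" "a \<in> P \<Longrightarrow> Sp M a \<subseteq> Sp V a"
    "a \<in> P \<Longrightarrow> b \<in> P \<Longrightarrow> a \<le> b \<Longrightarrow> x \<in> Sp M a \<Longrightarrow> Tr M a b x = Tr V a b x"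
  using assms by (auto simp: pers_submodule_def)

lemma pers_submodule_trans:
  "pers_submodule scale P M N \<Longrightarrow> pers_submodule scale P N V \<Longrightarrow> pers_submodule scale P M V"
  unfolding pers_submodule_def by (simp add: subset_iff)

lemma internal_direct_sum_pair:
  assumes "pers_module scale P V"
  shows "internal_direct_sum scale P V [M, N] \<longleftrightarrow>
    pers_submodule scale P M V \<and> pers_submodule scale P N V \<and>
    (\<forall>a\<in>P. direct_decomp (Sp V a) (Sp M a) (Sp N a))"
proof (cases "pers_submodule scale P M V \<and> pers_submodule scale P N V")
  case True
  have lists: "length xs = length [M, N] \<and> (\<forall>i<length [M, N]. xs ! i \<in> Sp ([M, N] ! i) a) \<and> v = sum_list xs
      \<longleftrightarrow> (\<exists>x y. xs = [x, y] \<and> x \<in> Sp M a \<and> y \<in> Sp N a \<and> v = x + y)" (is "?l \<longleftrightarrow> ?r") for xs a v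
  proof
    assume l: ?l
    then obtain x y where xs: "xs = [x, y]"
      by (metis (no_types, lifting) length_0_conv length_Suc_conv)
    have "\<forall>i<length [M, N]. xs ! i \<in> Sp ([M, N] ! i) a" using l by blast
    from this[rule_format, of 0] this[rule_format, of 1] show ?r using xs l by simp
  next
    assume ?r
    then show ?l by (auto simp: less_Suc_eq)
  qed
  have "(\<forall>v\<in>Sp V a. \<exists>!xs. \<exists>x y. xs = [x, y] \<and> x \<in> Sp M a \<and> y \<in> Sp N a \<and> v = x + y) \<longleftrightarrow>
    direct_decomp (Sp V a) (Sp M a) (Sp N a)" (is "?L \<longleftrightarrow> ?R") if a: "a \<in> P" for a
  proof -
    have sub: "Sp M a \<subseteq> Sp V a" "Sp N a \<subseteq> Sp V a" "subspace (Sp M a)" "subspace (Sp N a)"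
      "subspace (Sp V a)"
      using True pers_submoduleD(1,2)[of P M V] pers_submoduleD(1,2)[of P N V]
        pers_module_space(1)[OF _ a] assms a by blast+
    show ?thesis
    proof
      assume L: ?L
      show ?R
      proof (rule direct_decompI)
        show "x = 0" if x: "x \<in> Sp M a" "x \<in> Sp N a" for x
        proof -
          have "\<exists>!xs. \<exists>y z. xs = [y, z] \<and> y \<in> Sp M a \<and> z \<in> Sp N a \<and> x = y + z"
            by (rule bspec[OF L]) (use sub x in blast)
          moreover have "x = x + 0" "x = 0 + x" "0 \<in> Sp M a" "0 \<in> Sp N a"
            using sub subspace_0 by auto
          ultimately have "[x, 0] = [0, x]" using x by metis
          then show ?thesis by simp
        qed
        show "\<exists>x\<in>Sp M a. \<exists>y\<in>Sp N a. v = x + y" if "v \<in> Sp V a" for v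
          using bspec[OF L that] by (elim ex1E exE conjE) blast
      qed (use sub in auto)
    next
      assume R: ?R
      show ?L
      proof
        fix v assume "v \<in> Sp V a"
        then obtain x y where xy: "x \<in> Sp M a" "y \<in> Sp N a" "v = x + y"
          using direct_decompD(7)[OF R] by blast
        have "x' = x \<and> y' = y" if "x' \<in> Sp M a" "y' \<in> Sp N a" "v = x' + y'" for x' y'
        proof -
          have "x - x' = y' - y" using that xy by (simp add: algebra_simps)
          moreover have "x - x' \<in> Sp M a" "y' - y \<in> Sp N a"
            using that xy sub subspace_diff by auto
          ultimately have "x - x' = 0" using direct_decompD(6)[OF R] by metis
          then show ?thesis using that xy by auto
        qed
        then show "\<exists>!xs. \<exists>x y. xs = [x, y] \<and> x \<in> Sp M a \<and> y \<in> Sp N a \<and> v = x + y"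
          using xy by (intro ex1I[of _ "[x, y]"]) auto
      qed
    qed
  qed
  then show ?thesis
    using True unfolding internal_direct_sum_def lists by simp
qed (auto simp: internal_direct_sum_def)

text \<open>This allows the successive splittings of the construction to be composed.\<close>
lemma internal_direct_sum_refine:
  assumes V: "pers_module scale P V" and M: "internal_direct_sum scale P V [M, N]"
    and N: "internal_direct_sum scale P N Ks"
  shows "internal_direct_sum scale P V (M # Ks)"
proof -
  have dd: "pers_submodule scale P M V" "pers_submodule scale P N V"
    "\<And>a. a \<in> P \<Longrightarrow> direct_decomp (Sp V a) (Sp M a) (Sp N a)"
    using M internal_direct_sum_pair[OF V] by auto
  have subK: "\<forall>K\<in>set Ks. pers_submodule scale P K N"
    using N by (simp add: internal_direct_sum_def)
  have ex: "\<exists>!xs. length xs = length (M # Ks) \<and> (\<forall>i<length (M # Ks). xs ! i \<in> Sp ((M # Ks) ! i) a) \<and>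
      v = sum_list xs" if a: "a \<in> P" and v: "v \<in> Sp V a" for a v
  proof -
    define Q where "Q w xs \<longleftrightarrow> length xs = length Ks \<and> (\<forall>i<length Ks. xs ! i \<in> Sp (Ks ! i) a) \<and>
      w = sum_list xs" for w xs
    have lists: "length xs = length (M # Ks) \<and> (\<forall>i<length (M # Ks). xs ! i \<in> Sp ((M # Ks) ! i) a) \<and>
      v = sum_list xs \<longleftrightarrow> (\<exists>x ys. xs = x # ys \<and> x \<in> Sp M a \<and> Q (v - x) ys)" for xs
      by (cases xs) (auto simp: Q_def less_Suc_eq_0_disj algebra_simps)
    have sub: "subspace (Sp M a)" "subspace (Sp N a)"
      using dd(3)[OF a] direct_decompD by auto
    have QN: "w \<in> Sp N a" if "Q w ys" for w ys
    proof -
      have "sum_list ys \<in> Sp N a" if "set ys \<subseteq> Sp N a" for ys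
        using that by (induction ys) (auto simp: subspace_0[OF sub(2)] intro: subspace_add[OF sub(2)])
      moreover have "set ys \<subseteq> Sp N a"
      proof
        fix y assume "y \<in> set ys"
        then obtain i where i: "i < length Ks" "y = ys ! i"
          using \<open>Q w ys\<close> by (auto simp: Q_def in_set_conv_nth)
        then have "y \<in> Sp (Ks ! i) a" using \<open>Q w ys\<close> by (simp add: Q_def)
        moreover have "pers_submodule scale P (Ks ! i) N" using subK i(1) by simp
        ultimately show "y \<in> Sp N a" using pers_submoduleD(2) a by blast
      qed
      ultimately show ?thesis using \<open>Q w ys\<close> by (simp add: Q_def)
    qed
    have QE: "\<exists>!ys. Q w ys" if "w \<in> Sp N a" for w
      unfolding Q_def
      by (rule bspec[OF bspec[OF conjunct2[OF N[unfolded internal_direct_sum_def]] a] that])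
    obtain x y where xy: "x \<in> Sp M a" "y \<in> Sp N a" "v = x + y"
      using direct_decompD(7)[OF dd(3)[OF a] v] by blast
    have uniq: "x' = x" if "x' \<in> Sp M a" "v - x' \<in> Sp N a" for x'
    proof -
      have "x - x' \<in> Sp M a" using that xy sub subspace_diff by blast
      moreover have "x - x' = (v - x') - y" using xy(3) by simp
      then have "x - x' \<in> Sp N a" using that(2) xy(2) subspace_diff[OF sub(2)] by metis
      ultimately show ?thesis using direct_decompD(6)[OF dd(3)[OF a]] by force
    qed
    obtain ys where ys: "Q y ys" using QE xy by blast
    have "v - x = y" using xy by simp
    show ?thesis
      unfolding lists
    proof (rule ex1I[of _ "x # ys"])
      show "\<exists>x' ys'. x # ys = x' # ys' \<and> x' \<in> Sp M a \<and> Q (v - x') ys'"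
        using xy ys \<open>v - x = y\<close> by auto
      show "xs = x # ys" if ex': "\<exists>x ys. xs = x # ys \<and> x \<in> Sp M a \<and> Q (v - x) ys" for xs
      proof -
        obtain x' ys' where x': "xs = x' # ys'" "x' \<in> Sp M a" "Q (v - x') ys'" using ex' by blast
        then have "x' = x" using uniq QN by blast
        moreover have "ys' = ys" using x'(3) ys QE[OF xy(2)] \<open>x' = x\<close> \<open>v - x = y\<close> by metis
        ultimately show ?thesis using x'(1) by simp
      qed
    qed
  qed
  have all: "\<forall>K\<in>set (M # Ks). pers_submodule scale P K V"
    using dd(1,2) subK pers_submodule_trans[OF _ dd(2)] by (metis set_ConsD)
  show ?thesis
    unfolding internal_direct_sum_def by (intro conjI ballI ex, use all in blast)
qed

section \<open>Complements along a chain\<close>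

text \<open>A submodule \<open>S\<close> with surjective structure maps is a sum of interval modules whose intervals start at the
least element of the chain, and these are injective as modules over the chain. Concretely, at a new least element \<open>p\<close> let \<open>D\<close>
consist of the vectors that are mapped into the complements already chosen. Surjectivity gives
\<open>M p = S p + D\<close>, and a complement of \<open>S p \<inter> D\<close> in \<open>D\<close> is as required.\<close>
lemma chain_complement_of_surjective:
  assumes M: "pers_module scale P M" and "finite C" "\<forall>x\<in>C. \<forall>y\<in>C. x \<le> y \<or> y \<le> x" "C \<subseteq> P"
    and "\<And>a. a \<in> C \<Longrightarrow> subspace (S a) \<and> S a \<subseteq> Sp M a"
    and "\<And>a b. a \<in> C \<Longrightarrow> b \<in> C \<Longrightarrow> a \<le> b \<Longrightarrow> S b \<subseteq> Tr M a b ` S a"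
  shows "\<exists>X. (\<forall>a\<in>C. direct_decomp (Sp M a) (S a) (X a)) \<and>
    (\<forall>a\<in>C. \<forall>b\<in>C. a \<le> b \<longrightarrow> Tr M a b ` X a \<subseteq> X b)"
  using assms(2-)
proof (induction C rule: finite_chain_induct_min)
  case (insert C p)
  have "\<exists>X. (\<forall>a\<in>C. direct_decomp (Sp M a) (S a) (X a)) \<and>
    (\<forall>a\<in>C. \<forall>b\<in>C. a \<le> b \<longrightarrow> Tr M a b ` X a \<subseteq> X b)"
    by (rule insert.IH) (use insert.prems in auto)
  then obtain X where X0: "\<forall>a\<in>C. direct_decomp (Sp M a) (S a) (X a)"
    "\<forall>a\<in>C. \<forall>b\<in>C. a \<le> b \<longrightarrow> Tr M a b ` X a \<subseteq> X b"
    by (elim exE conjE)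
  note X = X0(1)[rule_format] X0(2)[rule_format]
  have p: "p \<in> P" "p \<notin> C" and Sp: "subspace (S p)" "S p \<subseteq> Sp M p" and C: "C \<subseteq> P"
    using insert.prems insert.hyps by auto
  define D where "D = {v \<in> Sp M p. \<forall>b\<in>C. Tr M p b v \<in> X b}"
  have le: "p \<le> b" if "b \<in> C" for b using insert.hyps(3) that by (simp add: order_less_imp_le)
  have XS: "subspace (X b)" "X b \<subseteq> Sp M b" if "b \<in> C" for b
    using direct_decompD(2,5)[OF X(1)[OF that]] .
  have D: "subspace D"
  proof (cases "C = {}")
    case True
    then show ?thesis using pers_module_space(1)[OF M p(1)] by (simp add: D_def)
  next
    case False
    then have "D = (\<Inter>b\<in>C. {v \<in> Sp M p. Tr M p b v \<in> X b})" by (auto simp: D_def)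
    then show ?thesis
      using pers_module_preimage_subspace[OF M p(1) _ le XS(1)] C by (auto intro!: subspace_Int)
  qed
  have sum: "\<exists>s\<in>S p. \<exists>d\<in>D. v = s + d" if v: "v \<in> Sp M p" for v
  proof (cases "C = {}")
    case True
    then show ?thesis using v subspace_0[OF Sp(1)] by (force simp: D_def)
  next
    case False
    then obtain b where b: "b \<in> C" "\<forall>x\<in>C. b \<le> x"
      using finite_chain_has_least insert.hyps by blast
    obtain s' x where s': "s' \<in> S b" "x \<in> X b" "Tr M p b v = s' + x"
      using direct_decompD(7)[OF X(1)[OF b(1)]] pers_module_map(1)[OF M p(1) _ le[OF b(1)] v] b C by blast
    obtain s where s: "s \<in> S p" "s' = Tr M p b s"
      using insert.prems(3)[of p b] s'(1) b le by auto
    have vs: "v - s \<in> Sp M p" using v s Sp pers_module_space(1)[OF M p(1)] subspace_diff by blast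
    have bv: "Tr M p b (v - s) = x"
    proof -
      have "b \<in> P" "s \<in> Sp M p" using b(1) C s(1) Sp(2) by auto
      then show ?thesis
        using pers_module_map_diff[OF M p(1) _ le[OF b(1)] v, of s] s(2) s'(3) by simp
    qed
    have "Tr M p c (v - s) \<in> X c" if c: "c \<in> C" for c
    proof -
      have "Tr M b c x \<in> X c" using X(2)[OF b(1) c] b(2) c s'(2) by blast
      moreover have "Tr M b c x = Tr M p c (v - s)"
        using pers_module_comp[OF M p(1) _ _ le[OF b(1)] _ vs, of c] bv b c C by auto
      ultimately show ?thesis by simp
    qed
    then have "v - s \<in> D" using vs by (simp add: D_def)
    then show ?thesis using s(1) by (metis add_diff_cancel_left' diff_add_cancel add.commute)
  qed
  have "subspace (S p \<inter> D)" using D Sp by (simp add: subspace_inter)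
  then obtain Xp where Xp: "direct_decomp D (S p \<inter> D) Xp"
    using complement_exists[OF D, of "S p \<inter> D"] by auto
  have XpD: "Xp \<subseteq> D" "subspace Xp" using direct_decompD[OF Xp] by auto
  have "direct_decomp (Sp M p) (S p) Xp"
  proof (rule direct_decompI)
    show "Xp \<subseteq> Sp M p" using XpD by (auto simp: D_def)
    show "x = 0" if "x \<in> S p" "x \<in> Xp" for x
      using direct_decompD(6)[OF Xp, of x] that XpD by auto
    show "\<exists>x\<in>S p. \<exists>y\<in>Xp. v = x + y" if v: "v \<in> Sp M p" for v
    proof -
      obtain s d where s: "s \<in> S p" "d \<in> D" "v = s + d" using sum[OF v] by blast
      obtain s' x where s': "s' \<in> S p" "x \<in> Xp" "d = s' + x"
        using direct_decompD(7)[OF Xp s(2)] by blast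
      have "v = (s + s') + x" using s s' by (simp add: add.assoc)
      then show ?thesis using s(1) s'(1,2) subspace_add[OF Sp(1)] by blast
    qed
  qed (use Sp XpD pers_module_space(1)[OF M p(1)] in auto)
  moreover have "Tr M p b ` Xp \<subseteq> X b" if "b \<in> C" for b
    using XpD that by (auto simp: D_def)
  moreover have "Tr M p p ` Xp \<subseteq> Xp"
    using XpD pers_module_id[OF M p(1)] by (auto simp: D_def subset_iff)
  moreover have "\<not> b \<le> p" if "b \<in> C" for b
    using insert.hyps(3) that by force
  ultimately show ?case
    using X p(2) by (intro exI[of _ "X(p := Xp)"]) auto
qed simp

text \<open>The dual statement: for a submodule \<open>S\<close>, the last hypothesis says that the quotient \<open>M / S\<close> has injective structure
maps. At a new greatest element \<open>t\<close>, the image of the complements already chosen meets \<open>S t\<close> only in zero, so it can be enlarged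
to a complement of \<open>S t\<close>.\<close>
lemma chain_complement_of_saturated:
  assumes M: "pers_module scale P M" and "finite C" "\<forall>x\<in>C. \<forall>y\<in>C. x \<le> y \<or> y \<le> x" "C \<subseteq> P"
    and "\<And>a. a \<in> C \<Longrightarrow> subspace (S a) \<and> S a \<subseteq> Sp M a"
    and "\<And>a b x. a \<in> C \<Longrightarrow> b \<in> C \<Longrightarrow> a \<le> b \<Longrightarrow> x \<in> Sp M a \<Longrightarrow> Tr M a b x \<in> S b \<Longrightarrow> x \<in> S a"
  shows "\<exists>X. (\<forall>a\<in>C. direct_decomp (Sp M a) (S a) (X a)) \<and>
    (\<forall>a\<in>C. \<forall>b\<in>C. a \<le> b \<longrightarrow> Tr M a b ` X a \<subseteq> X b)"
  using assms(2-)
proof (induction C rule: finite_chain_induct_max)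
  case (insert C t)
  have "\<exists>X. (\<forall>a\<in>C. direct_decomp (Sp M a) (S a) (X a)) \<and>
    (\<forall>a\<in>C. \<forall>b\<in>C. a \<le> b \<longrightarrow> Tr M a b ` X a \<subseteq> X b)"
  proof (rule insert.IH)
    show "x \<in> S a" if "a \<in> C" "b \<in> C" "a \<le> b" "x \<in> Sp M a" "Tr M a b x \<in> S b" for a b x
      using insert.prems(3)[of a b x] that by simp
  qed (use insert.prems(1,2) in auto)
  then obtain X where X0: "\<forall>a\<in>C. direct_decomp (Sp M a) (S a) (X a)"
    "\<forall>a\<in>C. \<forall>b\<in>C. a \<le> b \<longrightarrow> Tr M a b ` X a \<subseteq> X b"
    by (elim exE conjE)
  note X = X0(1)[rule_format] X0(2)[rule_format]
  have t: "t \<in> P" "t \<notin> C" and St: "subspace (S t)" "S t \<subseteq> Sp M t" and C: "C \<subseteq> P"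
    using insert.prems insert.hyps by auto
  have le: "b \<le> t" if "b \<in> C" for b using insert.hyps(3) that by (simp add: order_less_imp_le)
  have XS: "subspace (X b)" "X b \<subseteq> Sp M b" if "b \<in> C" for b
    using direct_decompD(2,5)[OF X(1)[OF that]] .
  have "\<exists>D. subspace D \<and> D \<subseteq> Sp M t \<and> (\<forall>x\<in>S t \<inter> D. x = 0) \<and> (\<forall>a\<in>C. Tr M a t ` X a \<subseteq> D)"
  proof (cases "C = {}")
    case True
    then show ?thesis
      using subspace_0[OF pers_module_space(1)[OF M t(1)]] by (intro exI[of _ "{0}"]) auto
  next
    case False
    then obtain b where b: "b \<in> C" "\<forall>x\<in>C. x \<le> b"
      using finite_chain_has_greatest insert.hyps by blast
    have bP: "b \<in> P" using b C by blast
    have "subspace (Tr M b t ` X b)"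
      using pers_module_image_subspace[OF M bP t(1) le XS] b by simp
    moreover have "Tr M b t ` X b \<subseteq> Sp M t"
      using XS(2)[OF b(1)] pers_module_map(1)[OF M bP t(1) le[OF b(1)]] by blast
    moreover have "x = 0" if "x \<in> S t" "x \<in> Tr M b t ` X b" for x
    proof -
      obtain y where y: "y \<in> X b" "x = Tr M b t y" using \<open>x \<in> Tr M b t ` X b\<close> by blast
      then have "y \<in> S b" using insert.prems(3)[of b t y] that(1) XS b le by auto
      then have "y = 0" using direct_decompD(6)[OF X(1)[OF b(1)]] y by blast
      then show ?thesis using y pers_module_map_zero[OF M bP t(1) le[OF b(1)]] by simp
    qed
    moreover have "Tr M a t ` X a \<subseteq> Tr M b t ` X b" if a: "a \<in> C" for a
    proof
      fix x assume "x \<in> Tr M a t ` X a"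
      then obtain y where y: "y \<in> X a" "x = Tr M a t y" by blast
      then have "x = Tr M b t (Tr M a b y)"
        using pers_module_comp[OF M _ bP t(1) _ le[OF b(1)], of a y] a b(2) C XS(2)[OF a]
        by (simp add: subset_iff)
      then show "x \<in> Tr M b t ` X b" using X(2)[OF a b(1)] b(2) a y by blast
    qed
    ultimately show ?thesis
      by (intro exI[of _ "Tr M b t ` X b"] conjI ballI) (assumption | blast)+
  qed
  then obtain D where D: "subspace D" "D \<subseteq> Sp M t" "\<forall>x\<in>S t \<inter> D. x = 0"
    and XD: "\<forall>a\<in>C. Tr M a t ` X a \<subseteq> D"
    by (elim exE conjE)
  obtain Xt where Xt: "D \<subseteq> Xt" "direct_decomp (Sp M t) (S t) Xt"
    using complement_above[OF pers_module_space(1)[OF M t(1)] St(1) D(1) St(2) D(2)] D(3) by blast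
  have "Tr M t t ` Xt \<subseteq> Xt"
    using direct_decompD(5)[OF Xt(2)] pers_module_id[OF M t(1)] by (auto simp: subset_iff)
  moreover have "Tr M a t ` X a \<subseteq> Xt" if "a \<in> C" for a
    using bspec[OF XD that] Xt(1) by (rule subset_trans)
  moreover have "\<not> t \<le> b" if "b \<in> C" for b
    using insert.hyps(3) that by force
  ultimately show ?case
    using X Xt(2) t(2) by (intro exI[of _ "X(t := Xt)"]) auto
qed simp

section \<open>Barcode bases\<close>

lemma span_image_finite:
  assumes "finite G" "x \<in> span (e ` G)"
  shows "\<exists>u. x = (\<Sum>g\<in>G. u g *s e g)"
  using assms
proof (induction G arbitrary: x rule: finite_induct)
  case (insert g G)
  then obtain k where "x - k *s e g \<in> span (e ` G)"
    by (auto simp: span_breakdown_eq)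
  then obtain u where u: "x - k *s e g = (\<Sum>g\<in>G. u g *s e g)"
    using insert.IH by blast
  have "(\<Sum>h\<in>insert g G. (u(g := k)) h *s e h) = k *s e g + (\<Sum>h\<in>G. (u(g := k)) h *s e h)"
    using insert.hyps by simp
  also have "(\<Sum>h\<in>G. (u(g := k)) h *s e h) = (\<Sum>h\<in>G. u h *s e h)"
    using insert.hyps by (intro sum.cong) auto
  finally have "x = (\<Sum>h\<in>insert g G. (u(g := k)) h *s e h)"
    using u by (simp add: algebra_simps)
  then show ?case by blast
qed simp

text \<open>A section \<open>g\<close> takes the value \<open>0\<close> at the points outside its bar, so that the bar is its support and
need not be recorded separately. The condition on the coefficients \<open>u\<close> expresses at once that distinct sections have distinct
nonzero values at \<open>a\<close> and that these values are linearly independent.\<close>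
definition barcode_basis :: "'b::order set \<Rightarrow> ('b, 'v) pmod \<Rightarrow> ('b \<Rightarrow> 'v) set \<Rightarrow> bool" where
  "barcode_basis P M G \<longleftrightarrow> finite G \<and>
     (\<forall>a\<in>P. Sp M a = span ((\<lambda>g. g a) ` G) \<and>
        (\<forall>u. (\<Sum>g\<in>G. u g *s g a) = 0 \<longrightarrow> (\<forall>g\<in>G. g a \<noteq> 0 \<longrightarrow> u g = 0))) \<and>
     (\<forall>a\<in>P. \<forall>b\<in>P. a \<le> b \<longrightarrow> (\<forall>g\<in>G. g a \<noteq> 0 \<longrightarrow> Tr M a b (g a) = g b))"

abbreviation bars :: "'b set \<Rightarrow> ('b \<Rightarrow> 'v) set \<Rightarrow> 'b set set" where
  "bars P G \<equiv> (\<lambda>g. {a \<in> P. g a \<noteq> 0}) ` G"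

lemma barcode_basisD:
  assumes "barcode_basis P M G"
  shows "finite G" "a \<in> P \<Longrightarrow> Sp M a = span ((\<lambda>g. g a) ` G)"
    "a \<in> P \<Longrightarrow> (\<Sum>g\<in>G. u g *s g a) = 0 \<Longrightarrow> g \<in> G \<Longrightarrow> g a \<noteq> 0 \<Longrightarrow> u g = 0"
    "a \<in> P \<Longrightarrow> b \<in> P \<Longrightarrow> a \<le> b \<Longrightarrow> g \<in> G \<Longrightarrow> g a \<noteq> 0 \<Longrightarrow> Tr M a b (g a) = g b"
  using assms unfolding barcode_basis_def by blast+

text \<open>A relation between the values of the sections splits into one relation in each summand. Sections common to
\<open>G\<close> and \<open>H\<close> have their values in the intersection of the summands, so they vanish on \<open>P\<close>.\<close>
lemma barcode_basis_sum:
  assumes V: "pers_module scale P V" and MN: "internal_direct_sum scale P V [M, N]"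
    and G: "barcode_basis P M G" and H: "barcode_basis P N H"
  shows "barcode_basis P V (G \<union> H)"
  unfolding barcode_basis_def
proof (intro conjI ballI allI impI)
  have sub: "pers_submodule scale P M V" "pers_submodule scale P N V"
    and dd: "\<And>a. a \<in> P \<Longrightarrow> direct_decomp (Sp V a) (Sp M a) (Sp N a)"
    using MN internal_direct_sum_pair[OF V] by auto
  have fin: "finite G" "finite H" using G H barcode_basisD(1) by auto
  show "finite (G \<union> H)" using fin by simp
  have inM: "g a \<in> Sp M a" if "g \<in> G" "a \<in> P" for g a
    using barcode_basisD(2)[OF G that(2)] that(1) by (auto intro: span_base)
  have inN: "g a \<in> Sp N a" if "g \<in> H" "a \<in> P" for g a
    using barcode_basisD(2)[OF H that(2)] that(1) by (auto intro: span_base)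
  fix a assume a: "a \<in> P"
  show "Sp V a = span ((\<lambda>g. g a) ` (G \<union> H))"
    using dd[OF a] barcode_basisD(2)[OF G a] barcode_basisD(2)[OF H a]
    by (simp add: image_Un span_Un direct_decomp_def)
  show "u g = 0" if u: "(\<Sum>g\<in>G \<union> H. u g *s g a) = 0" and g: "g \<in> G \<union> H" "g a \<noteq> 0" for u g
  proof -
    \<comment> \<open>Sections in \<open>G \<inter> H\<close> are counted with \<open>G\<close>, so that the sum over the union splits.\<close>
    define w where "w g = (if g \<in> G then 0 else u g)" for g
    have "(\<Sum>g\<in>H. w g *s g a) = (\<Sum>g\<in>H - G. u g *s g a)"
      by (rule sum.mono_neutral_cong_right) (auto simp: w_def fin)
    then have sum0: "(\<Sum>g\<in>G. u g *s g a) + (\<Sum>g\<in>H. w g *s g a) = 0"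
      using u fin sum.union_disjoint[of G "H - G" "\<lambda>g. u g *s g a"] by simp
    have s: "subspace (Sp M a)" "subspace (Sp N a)"
      using direct_decompD(1,2)[OF dd[OF a]] .
    have "(\<Sum>g\<in>G. u g *s g a) \<in> Sp M a" "(\<Sum>g\<in>H. w g *s g a) \<in> Sp N a"
      using s inM inN a by (auto intro!: subspace_sum subspace_scale)
    moreover have "(\<Sum>g\<in>G. u g *s g a) = - (\<Sum>g\<in>H. w g *s g a)"
      using sum0 by (simp add: add_eq_0_iff2)
    ultimately have "(\<Sum>g\<in>G. u g *s g a) = 0"
      using direct_decompD(6)[OF dd[OF a]] subspace_neg[OF s(2)] by metis
    then have "(\<Sum>g\<in>H. w g *s g a) = 0" using sum0 by simp
    show ?thesis
    proof (cases "g \<in> G")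
      case True
      then show ?thesis using barcode_basisD(3)[OF G a \<open>(\<Sum>g\<in>G. u g *s g a) = 0\<close>] g by blast
    next
      case False
      then show ?thesis
        using barcode_basisD(3)[OF H a \<open>(\<Sum>g\<in>H. w g *s g a) = 0\<close>, of g] g by (simp add: w_def)
    qed
  qed
  fix b g assume b: "b \<in> P" "a \<le> b" "g \<in> G \<union> H" "g a \<noteq> 0"
  show "Tr V a b (g a) = g b"
  proof (cases "g \<in> G")
    case True
    then show ?thesis
      using barcode_basisD(4)[OF G a b(1,2) True b(4)] pers_submoduleD(3)[OF sub(1) a b(1,2)] inM a by metis
  next
    case False
    then have g: "g \<in> H" using b by blast
    then show ?thesis
      using barcode_basisD(4)[OF H a b(1,2) g b(4)] pers_submoduleD(3)[OF sub(2) a b(1,2)] inN a by metis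
  qed
qed

text \<open>The linear combinations \<open>\<psi>\<close> of the sections give an isomorphism from the direct sum of the interval modules on the
bars; the isomorphism sought is its inverse.\<close>
lemma sum_of_interval_modules_if_barcode_basis:
  assumes M: "pers_module scale P M" and G: "barcode_basis P M G" and bars: "bars P G \<subseteq> \<J>"
  shows "sum_of_interval_modules scale P \<J> M"
proof -
  have fin: "finite G" by (rule barcode_basisD(1)[OF G])
  obtain h :: "('a \<Rightarrow> 'v) \<Rightarrow> nat" where h: "inj_on h G"
    using finite_imp_inj_to_nat_seg[OF fin] by blast
  define r where "r = inv_into G h"
  have r: "r (h g) = g" if "g \<in> G" for g using h that by (simp add: r_def)
  define J where "J i = {a \<in> P. r i a \<noteq> 0}" for i
  let ?S = "direct_sum (h ` G) (\<lambda>i. interval_module (J i) :: ('a, 'k) pmod)"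
  define \<psi> where "\<psi> a f = (\<Sum>g\<in>G. f (h g) *s g a)" for a and f :: "nat \<Rightarrow> 'k"
  have inS: "f \<in> Sp ?S a \<longleftrightarrow> (\<forall>g\<in>G. g a = 0 \<longrightarrow> f (h g) = 0) \<and> (\<forall>i. i \<notin> h ` G \<longrightarrow> f i = 0)"
    if "a \<in> P" for f a
    using that by (auto simp: direct_sum_def interval_module_def J_def r)
  have \<psi>_in: "\<psi> a f \<in> Sp M a" if "a \<in> P" for a f
    unfolding \<psi>_def barcode_basisD(2)[OF G that] by (intro span_sum span_scale span_base) auto
  have \<psi>_inj: "inj_on (\<psi> a) (Sp ?S a)" if a: "a \<in> P" for a
  proof (rule inj_onI)
    fix f f' assume f: "f \<in> Sp ?S a" "f' \<in> Sp ?S a" "\<psi> a f = \<psi> a f'"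
    have "(\<Sum>g\<in>G. (f (h g) - f' (h g)) *s g a) = 0"
      using f(3) by (simp add: \<psi>_def scale_left_diff_distrib sum_subtractf)
    then have "f (h g) = f' (h g)" if "g \<in> G" "g a \<noteq> 0" for g
      using barcode_basisD(3)[OF G a, of "\<lambda>g. f (h g) - f' (h g)" g] that by simp
    then have "f i = f' i" for i
      using f(1,2) inS[OF a] by (cases "i \<in> h ` G") (auto, metis)
    then show "f = f'" by (rule ext)
  qed
  have \<psi>_surj: "\<exists>f\<in>Sp ?S a. x = \<psi> a f" if a: "a \<in> P" and x: "x \<in> Sp M a" for a x
  proof -
    obtain u where u: "x = (\<Sum>g\<in>G. u g *s g a)"
      using span_image_finite[OF fin] x barcode_basisD(2)[OF G a] by blast
    define f where "f i = (if i \<in> h ` G \<and> r i a \<noteq> 0 then u (r i) else 0)" for i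
    have "f \<in> Sp ?S a" using inS[OF a] by (auto simp: f_def r)
    moreover have "x = \<psi> a f"
      unfolding u \<psi>_def by (rule sum.cong) (auto simp: f_def r)
    ultimately show ?thesis by blast
  qed
  have \<psi>_bij: "bij_betw (\<psi> a) (Sp ?S a) (Sp M a)" if "a \<in> P" for a
    using \<psi>_inj[OF that] \<psi>_in[OF that] \<psi>_surj[OF that] by (auto simp: bij_betw_def)
  define \<phi> where "\<phi> a = inv_into (Sp ?S a) (\<psi> a)" for a
  have \<phi>_in: "\<phi> a x \<in> Sp ?S a" and \<psi>\<phi>: "\<psi> a (\<phi> a x) = x" if "a \<in> P" "x \<in> Sp M a" for a x
    using \<psi>_bij[OF that(1)] that(2) unfolding \<phi>_def bij_betw_def
    by (simp_all add: inv_into_into f_inv_into_f)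
  have \<phi>_eq: "\<phi> a x = f" if "a \<in> P" "f \<in> Sp ?S a" "\<psi> a f = x" for a x f
    using \<psi>_inj[OF that(1)] that unfolding \<phi>_def by (metis inv_into_f_f)
  have lin: "lin_map scale (fun_scale (*)) (Sp M a) (Sp ?S a) (\<phi> a)" if a: "a \<in> P" for a
    unfolding lin_map_def
  proof (intro conjI ballI allI)
    show "\<phi> a (x + y) = \<phi> a x + \<phi> a y" if "x \<in> Sp M a" "y \<in> Sp M a" for x y
    proof (rule \<phi>_eq[OF a])
      show "\<phi> a x + \<phi> a y \<in> Sp ?S a"
        using \<phi>_in[OF a that(1)] \<phi>_in[OF a that(2)] inS[OF a] by auto
      have "\<psi> a (\<phi> a x + \<phi> a y) = \<psi> a (\<phi> a x) + \<psi> a (\<phi> a y)"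
        by (simp add: \<psi>_def scale_left_distrib sum.distrib)
      then show "\<psi> a (\<phi> a x + \<phi> a y) = x + y" using \<psi>\<phi> a that by simp
    qed
    show "\<phi> a (c *s x) = fun_scale (*) c (\<phi> a x)" if "x \<in> Sp M a" for c x
    proof (rule \<phi>_eq[OF a])
      show "fun_scale (*) c (\<phi> a x) \<in> Sp ?S a"
        using \<phi>_in[OF a that] inS[OF a] by (auto simp: fun_scale_def)
      have "\<psi> a (fun_scale (*) c (\<phi> a x)) = c *s \<psi> a (\<phi> a x)"
        by (simp add: \<psi>_def fun_scale_def scale_sum_right)
      then show "\<psi> a (fun_scale (*) c (\<phi> a x)) = c *s x" using \<psi>\<phi> a that by simp
    qed
  qed (use \<phi>_in a in blast)
  have natural: "\<phi> b (Tr M a b x) = Tr ?S a b (\<phi> a x)" if ab: "a \<in> P" "b \<in> P" "a \<le> b" and x: "x \<in> Sp M a" for a b x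
  proof (rule \<phi>_eq[OF ab(2)])
    let ?f = "\<phi> a x"
    have TrS: "Tr ?S a b ?f (h g) = (if g a \<noteq> 0 \<and> g b \<noteq> 0 then ?f (h g) else 0)" if "g \<in> G" for g
      using that ab by (auto simp: direct_sum_def interval_module_def J_def r)
    show "Tr ?S a b ?f \<in> Sp ?S b"
      using inS[OF ab(2)] TrS by (auto simp: direct_sum_def)
    have ga: "g a \<in> Sp M a" if "g \<in> G" for g
      using barcode_basisD(2)[OF G ab(1)] that by (auto intro: span_base)
    have "Tr M a b x = Tr M a b (\<psi> a ?f)" using \<psi>\<phi>[OF ab(1) x] by simp
    also have "\<dots> = (\<Sum>g\<in>G. ?f (h g) *s Tr M a b (g a))"
      unfolding \<psi>_def by (rule pers_module_map_sum[OF M ab ga])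
    also have "\<dots> = (\<Sum>g\<in>G. Tr ?S a b ?f (h g) *s g b)"
    proof (rule sum.cong[OF refl])
      fix g assume g: "g \<in> G"
      show "?f (h g) *s Tr M a b (g a) = Tr ?S a b ?f (h g) *s g b"
        using barcode_basisD(4)[OF G ab g] pers_module_map_zero[OF M ab] TrS[OF g]
        by (cases "g a = 0") auto
    qed
    finally show "\<psi> b (Tr ?S a b ?f) = Tr M a b x" by (simp add: \<psi>_def)
  qed
  have "bij_betw (\<phi> a) (Sp M a) (Sp ?S a)" if "a \<in> P" for a
    unfolding \<phi>_def by (rule bij_betw_inv_into[OF \<psi>_bij[OF that]])
  then have "pers_isomorphic scale (fun_scale (*)) P M ?S"
    unfolding pers_isomorphic_def using lin natural by blast
  moreover have "\<forall>i\<in>h ` G. J i \<in> \<J>"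
    using bars by (auto simp: J_def r)
  ultimately show ?thesis
    unfolding sum_of_interval_modules_def using fin by (intro exI[of _ "h ` G"] exI[of _ J]) auto
qed

text \<open>A module generated at \<open>p\<close> is the quotient of a constant module by the kernels of the structure maps out of \<open>p\<close>.
If \<open>T\<close> is adapted to a kernel, then the vectors of \<open>T\<close> outside the kernel map to a basis of the quotient.\<close>
lemma barcode_basis_of_generated:
  assumes M: "pers_module scale P M" and p: "p \<in> P"
    and gen: "\<And>a. a \<in> P \<Longrightarrow> p \<le> a \<Longrightarrow> Sp M a = Tr M p a ` Sp M p"
    and off: "\<And>a. a \<in> P \<Longrightarrow> \<not> p \<le> a \<Longrightarrow> Sp M a = {0}"
    and T: "independent T" "span T = Sp M p"
    and adapted: "\<And>a. a \<in> P \<Longrightarrow> p \<le> a \<Longrightarrow>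
      {x \<in> Sp M p. Tr M p a x = 0} \<subseteq> span (T \<inter> {x \<in> Sp M p. Tr M p a x = 0})"
  shows "barcode_basis P M ((\<lambda>x a. if p \<le> a then Tr M p a x else 0) ` T)"
proof -
  define e where "e x a = (if p \<le> a then Tr M p a x else 0)" for x a
  have TM: "T \<subseteq> Sp M p" using T span_superset by blast
  have ep: "e x p = x" if "x \<in> T" for x
    using that TM pers_module_id[OF M p] by (auto simp: e_def)
  have inj: "inj_on e T" using ep by (metis inj_onI)
  have fin: "finite T"
    using pers_module_space(2)[OF M p] independent_span_bound[OF _ T(1)] TM by auto
  have spaces: "Sp M a = span ((\<lambda>g. g a) ` e ` T)" if a: "a \<in> P" for a
  proof (cases "p \<le> a")
    case True
    have "(\<lambda>g. g a) ` e ` T = Tr M p a ` T" using True by (simp add: image_image e_def)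
    then show ?thesis
      using gen[OF a True] T(2) pers_module_span_image[OF M p a True TM] by simp
  next
    case False
    have "(\<lambda>g. g a) ` e ` T \<subseteq> {0}" using False by (auto simp: e_def)
    then have "span ((\<lambda>g. g a) ` e ` T) \<subseteq> {0}" by (rule span_minimal) simp
    then show ?thesis using off[OF a False] span_zero by auto
  qed
  have indep: "u g = 0" if a: "a \<in> P" and u: "(\<Sum>g\<in>e ` T. u g *s g a) = 0" and g: "g \<in> e ` T" "g a \<noteq> 0"
    for a u g
  proof -
    obtain x where x: "x \<in> T" "g = e x" using g by blast
    have pa: "p \<le> a" using g x by (auto simp: e_def split: if_splits)
    let ?y = "\<Sum>x\<in>T. u (e x) *s x" and ?K = "{x \<in> Sp M p. Tr M p a x = 0}"
    have "(\<Sum>x\<in>T. u (e x) *s Tr M p a x) = 0"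
      using u by (simp add: sum.reindex[OF inj] e_def pa)
    then have "Tr M p a ?y = 0"
      using pers_module_map_sum[OF M p a pa, of T "\<lambda>x. x" "\<lambda>x. u (e x)"] TM by auto
    moreover have "?y \<in> Sp M p"
      using T(2) by (metis (no_types, lifting) span_base span_scale span_sum)
    ultimately have "?y \<in> span (T \<inter> ?K)" using adapted[OF a pa] by blast
    then obtain w where w: "?y = (\<Sum>x\<in>T \<inter> ?K. w x *s x)"
      using span_image_finite[of "T \<inter> ?K" ?y "\<lambda>x. x"] fin by auto
    define w' where "w' x = (if x \<in> ?K then w x else 0)" for x
    have "?y = (\<Sum>x\<in>T. w' x *s x)"
      unfolding w by (rule sum.mono_neutral_cong_left) (auto simp: fin w'_def)
    then have "(\<Sum>x\<in>T. (u (e x) - w' x) *s x) = 0"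
      by (simp add: scale_left_diff_distrib sum_subtractf)
    then have "u (e x) - w' x = 0"
      using independentD[OF T(1) fin subset_refl, of "\<lambda>x. u (e x) - w' x" x] x by blast
    moreover have "w' x = 0" using g x pa by (simp add: e_def w'_def)
    ultimately show ?thesis using x by simp
  qed
  have maps: "Tr M a b (g a) = g b" if ab: "a \<in> P" "b \<in> P" "a \<le> b" and g: "g \<in> e ` T" "g a \<noteq> 0" for a b g
  proof -
    obtain x where x: "x \<in> T" "g = e x" using g by blast
    have pa: "p \<le> a" using g x by (auto simp: e_def split: if_splits)
    then have "p \<le> b" using ab(3) by (rule order_trans)
    then show ?thesis
      using pers_module_comp[OF M p ab(1,2) pa ab(3), of x] x TM pa by (auto simp: e_def)
  qed
  have "barcode_basis P M (e ` T)"
    unfolding barcode_basis_def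
    by (intro conjI ballI allI impI) (use fin spaces indep maps in blast)+
  then show ?thesis by (simp add: e_def[abs_def])
qed

text \<open>Dually, a module that embeds into a constant module on its space at \<open>q\<close> is determined by the images there. If \<open>T\<close> is
adapted to an image, then the preimages of the vectors of \<open>T\<close> in that image form a basis.\<close>
lemma barcode_basis_of_cogenerated:
  assumes M: "pers_module scale P M" and q: "q \<in> P" and top: "\<And>a. a \<in> P \<Longrightarrow> a \<le> q"
    and inj: "\<And>a x. a \<in> P \<Longrightarrow> x \<in> Sp M a \<Longrightarrow> Tr M a q x = 0 \<Longrightarrow> x = 0"
    and T: "independent T" "span T = Sp M q"
    and adapted: "\<And>a. a \<in> P \<Longrightarrow> Tr M a q ` Sp M a \<subseteq> span (T \<inter> Tr M a q ` Sp M a)"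
  obtains G where "barcode_basis P M G" "bars P G = (\<lambda>x. {a \<in> P. x \<in> Tr M a q ` Sp M a}) ` T"
proof -
  have TM: "T \<subseteq> Sp M q" using T span_superset by blast
  have fin: "finite T"
    using pers_module_space(2)[OF M q] independent_span_bound[OF _ T(1)] TM by auto
  have sub: "subspace (Sp M a)" if "a \<in> P" for a using pers_module_space(1)[OF M that] .
  have injon: "x = y" if "a \<in> P" "x \<in> Sp M a" "y \<in> Sp M a" "Tr M a q x = Tr M a q y" for a x y
  proof -
    have "Tr M a q (x - y) = 0" using pers_module_map_diff[OF M that(1) q top[OF that(1)] that(2,3)] that(4) by simp
    then show ?thesis using inj[OF that(1), of "x - y"] subspace_diff[OF sub] that by auto
  qed
  define e where "e x a = (if x \<in> Tr M a q ` Sp M a then inv_into (Sp M a) (Tr M a q) x else 0)" for x a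
  have e1: "e x a \<in> Sp M a" "Tr M a q (e x a) = x" if "x \<in> Tr M a q ` Sp M a" for x a
    using that by (auto simp: e_def inv_into_into f_inv_into_f)
  have T0: "x \<noteq> 0" if "x \<in> T" for x using T(1) that dependent_zero by blast
  have e0: "e x a \<noteq> 0 \<longleftrightarrow> x \<in> Tr M a q ` Sp M a" if "x \<in> T" "a \<in> P" for x a
    using e1(2)[of x a] T0[OF that(1)] pers_module_map_zero[OF M that(2) q top[OF that(2)]]
    by (auto simp: e_def)
  have ein: "e x a \<in> Sp M a" if "a \<in> P" for x a
    using e1(1)[of x a] subspace_0[OF sub[OF that]] by (cases "x \<in> Tr M a q ` Sp M a") (auto simp: e_def)
  have eq: "e x q = x" if "x \<in> T" for x
  proof -
    have "x \<in> Sp M q" using that TM by blast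
    then have "x \<in> Tr M q q ` Sp M q" using pers_module_id[OF M q] by force
    then show ?thesis using e1[of x q] pers_module_id[OF M q] by metis
  qed
  have einj: "inj_on e T" using eq by (metis inj_onI)
  have spaces: "Sp M a = span ((\<lambda>g. g a) ` e ` T)" if a: "a \<in> P" for a
  proof
    show "span ((\<lambda>g. g a) ` e ` T) \<subseteq> Sp M a"
      using ein[OF a] sub[OF a] by (intro span_minimal) auto
    show "Sp M a \<subseteq> span ((\<lambda>g. g a) ` e ` T)"
    proof
      fix v assume v: "v \<in> Sp M a"
      let ?I = "Tr M a q ` Sp M a"
      have "Tr M a q v \<in> span (T \<inter> ?I)" using adapted[OF a] v by blast
      then obtain w where w: "Tr M a q v = (\<Sum>x\<in>T \<inter> ?I. w x *s x)"
        using span_image_finite[of "T \<inter> ?I" "Tr M a q v" "\<lambda>x. x"] fin by auto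
      have "Tr M a q (\<Sum>x\<in>T \<inter> ?I. w x *s e x a) = (\<Sum>x\<in>T \<inter> ?I. w x *s Tr M a q (e x a))"
        by (rule pers_module_map_sum[OF M a q top[OF a] ein[OF a]])
      also have "\<dots> = (\<Sum>x\<in>T \<inter> ?I. w x *s x)"
        by (rule sum.cong[OF refl]) (simp add: e1(2))
      finally have "Tr M a q (\<Sum>x\<in>T \<inter> ?I. w x *s e x a) = Tr M a q v"
        using w by simp
      moreover have "(\<Sum>x\<in>T \<inter> ?I. w x *s e x a) \<in> Sp M a"
        by (intro subspace_sum subspace_scale sub[OF a] ein[OF a])
      ultimately have "v = (\<Sum>x\<in>T \<inter> ?I. w x *s e x a)"
        using injon[OF a v] by simp
      also have "\<dots> \<in> span ((\<lambda>g. g a) ` e ` T)"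
        by (intro span_sum span_scale span_base) auto
      finally show "v \<in> span ((\<lambda>g. g a) ` e ` T)" .
    qed
  qed
  have indep: "u g = 0" if a: "a \<in> P" and u: "(\<Sum>g\<in>e ` T. u g *s g a) = 0" and g: "g \<in> e ` T" "g a \<noteq> 0"
    for a u g
  proof -
    obtain x where x: "x \<in> T" "g = e x" using g by blast
    define w where "w x = (if x \<in> Tr M a q ` Sp M a then u (e x) else 0)" for x
    have "0 = Tr M a q (\<Sum>x\<in>T. u (e x) *s e x a)"
      using u pers_module_map_zero[OF M a q top[OF a]] by (simp add: sum.reindex[OF einj])
    also have "\<dots> = (\<Sum>x\<in>T. u (e x) *s Tr M a q (e x a))"
      by (rule pers_module_map_sum[OF M a q top[OF a] ein[OF a]])
    also have "\<dots> = (\<Sum>x\<in>T. w x *s x)"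
    proof (rule sum.cong[OF refl])
      fix x assume "x \<in> T"
      show "u (e x) *s Tr M a q (e x a) = w x *s x"
        using e1(2)[of x a] pers_module_map_zero[OF M a q top[OF a]]
        by (cases "x \<in> Tr M a q ` Sp M a") (auto simp: w_def e_def)
    qed
    finally have "w x = 0"
      using independentD[OF T(1) fin subset_refl _ x(1), of w] by simp
    then show ?thesis using e0[OF x(1) a] g x by (simp add: w_def)
  qed
  have maps: "Tr M a b (g a) = g b" if ab: "a \<in> P" "b \<in> P" "a \<le> b" and g: "g \<in> e ` T" "g a \<noteq> 0" for a b g
  proof -
    obtain x where x: "x \<in> T" "g = e x" using g by blast
    then have xa: "x \<in> Tr M a q ` Sp M a" using e0 g ab by blast
    have in_b: "Tr M a b (e x a) \<in> Sp M b" using pers_module_map(1)[OF M ab e1(1)[OF xa]] .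
    have "Tr M b q (Tr M a b (e x a)) = x"
      using pers_module_comp[OF M ab(1,2) q ab(3) top[OF ab(2)] e1(1)[OF xa]] e1(2)[OF xa] by simp
    moreover from this have "x \<in> Tr M b q ` Sp M b" using in_b by force
    ultimately show ?thesis
      using injon[OF ab(2) in_b e1(1)] e1(2) x by auto
  qed
  have "barcode_basis P M (e ` T)"
    unfolding barcode_basis_def
    by (intro conjI ballI allI impI) (use fin spaces indep maps in blast)+
  moreover have "bars P (e ` T) = (\<lambda>x. {a \<in> P. x \<in> Tr M a q ` Sp M a}) ` T"
    unfolding image_image using e0 by (intro image_cong) auto
  ultimately show thesis ..
qed

section \<open>Modules supported on a chain\<close>

lemma kernels_form_chain:
  assumes M: "pers_module scale P M" and p: "p \<in> P" and "C \<subseteq> P" "\<And>a. a \<in> C \<Longrightarrow> p \<le> a"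
    and "\<forall>x\<in>C. \<forall>y\<in>C. x \<le> y \<or> y \<le> x"
  defines "\<F> \<equiv> (\<lambda>a. {x \<in> Sp M p. Tr M p a x = 0}) ` C"
  shows "\<forall>F\<in>\<F>. \<forall>H\<in>\<F>. F \<subseteq> H \<or> H \<subseteq> F"
proof -
  have "{x \<in> Sp M p. Tr M p a x = 0} \<subseteq> {x \<in> Sp M p. Tr M p b x = 0}"
    if "a \<in> C" "b \<in> C" "a \<le> b" for a b
  proof clarify
    fix x assume x: "x \<in> Sp M p" "Tr M p a x = 0"
    have P: "a \<in> P" "b \<in> P" using that assms(3) by auto
    have "Tr M p b x = Tr M a b (Tr M p a x)"
      using pers_module_comp[OF M p P assms(4)[OF that(1)] that(3) x(1)] by simp
    then show "Tr M p b x = 0" using x(2) pers_module_map_zero[OF M P that(3)] by simp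
  qed
  then show ?thesis unfolding \<F>_def by (rule chain_of_monotone_images[OF assms(5)])
qed

lemma images_form_chain:
  assumes M: "pers_module scale P M" and q: "q \<in> P" and "C \<subseteq> P" "\<And>a. a \<in> C \<Longrightarrow> a \<le> q"
    and "\<forall>x\<in>C. \<forall>y\<in>C. x \<le> y \<or> y \<le> x"
  defines "\<F> \<equiv> (\<lambda>a. Tr M a q ` Sp M a) ` C"
  shows "\<forall>F\<in>\<F>. \<forall>H\<in>\<F>. F \<subseteq> H \<or> H \<subseteq> F"
proof -
  have "Tr M a q ` Sp M a \<subseteq> Tr M b q ` Sp M b"
    if "a \<in> C" "b \<in> C" "a \<le> b" for a b
  proof clarify
    fix x assume x: "x \<in> Sp M a"
    have P: "a \<in> P" "b \<in> P" using that assms(3) by auto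
    have "Tr M a q x = Tr M b q (Tr M a b x)"
      using pers_module_comp[OF M P q that(3) assms(4)[OF that(2)] x] by simp
    then show "Tr M a q x \<in> Tr M b q ` Sp M b"
      using pers_module_map(1)[OF M P that(3) x] by blast
  qed
  then show ?thesis unfolding \<F>_def by (rule chain_of_monotone_images[OF assms(5)])
qed

text \<open>Induction on the chain, removing its least element \<open>p\<close>: the submodule generated by the space at \<open>p\<close> has a
complement, which vanishes at \<open>p\<close> and is thus supported on the rest of the chain.\<close>
lemma barcode_basis_of_chain_supported:
  assumes "finite C" "\<forall>x\<in>C. \<forall>y\<in>C. x \<le> y \<or> y \<le> x" "C \<subseteq> P"
    and "pers_module scale P M" "\<And>a. a \<in> P \<Longrightarrow> a \<notin> C \<Longrightarrow> Sp M a = {0}"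
  shows "\<exists>G. barcode_basis P M G \<and> bars P G \<subseteq> {chain_interval C s t | s t. s \<in> C \<and> t \<in> C \<and> s \<le> t}"
  using assms
proof (induction C arbitrary: M rule: finite_chain_induct_min)
  case empty
  then have "barcode_basis P M {}" by (auto simp: barcode_basis_def)
  then show ?case by blast
next
  case (insert C p)
  note M = insert.prems(2)
  let ?C = "insert p C"
  have p: "p \<in> P" and CP: "?C \<subseteq> P" using insert.prems(1) by auto
  have pC: "p \<notin> C" using insert.hyps(3) by blast
  have le: "p \<le> a" if "a \<in> ?C" for a using that insert.hyps(3) by auto
  have chain: "\<forall>x\<in>?C. \<forall>y\<in>?C. x \<le> y \<or> y \<le> x" using insert.hyps(2) le by blast
  have finC: "finite ?C" using insert.hyps(1) by simp
  have sub: "subspace (Sp M a)" if "a \<in> P" for a using pers_module_space(1)[OF M that] .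
  have off: "Sp M a = {0}" if "a \<in> P" "a \<notin> ?C" for a using insert.prems(3)[OF that] .
  define S where "S a = (if a \<in> ?C then Tr M p a ` Sp M p else {0})" for a
  have Sp: "S p = Sp M p" using pers_module_id[OF M p] by (auto simp: S_def)
  have SC: "S a = Tr M p a ` Sp M p" if "a \<in> ?C" for a using that by (simp add: S_def)
  have Ssub: "subspace (S a) \<and> S a \<subseteq> Sp M a" if "a \<in> P" for a
  proof (cases "a \<in> ?C")
    case True
    then show ?thesis
      using pers_module_image_subspace[OF M p that le[OF True] sub[OF p] subset_refl]
        pers_module_map(1)[OF M p that le[OF True]] by (auto simp: SC)
  next
    case False
    then show ?thesis using subspace_0[OF sub[OF that]] by (auto simp: S_def)
  qed
  have Smap: "Tr M a b ` S a = S b" if "a \<in> ?C" "b \<in> ?C" "a \<le> b" for a b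
  proof -
    have P: "a \<in> P" "b \<in> P" using that CP by auto
    have "Tr M a b (Tr M p a x) = Tr M p b x" if "x \<in> Sp M p" for x
      using pers_module_comp[OF M p P le[OF \<open>a \<in> ?C\<close>] \<open>a \<le> b\<close> that] .
    then show ?thesis using that by (simp add: SC image_image)
  qed
  have "\<exists>X. (\<forall>a\<in>?C. direct_decomp (Sp M a) (S a) (X a)) \<and>
    (\<forall>a\<in>?C. \<forall>b\<in>?C. a \<le> b \<longrightarrow> Tr M a b ` X a \<subseteq> X b)"
  proof (rule chain_complement_of_surjective[OF M finC chain CP])
    show "subspace (S a) \<and> S a \<subseteq> Sp M a" if "a \<in> ?C" for a using Ssub that CP by blast
    show "S b \<subseteq> Tr M a b ` S a" if "a \<in> ?C" "b \<in> ?C" "a \<le> b" for a b using Smap[OF that] by simp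
  qed
  then obtain X where X0: "\<forall>a\<in>?C. direct_decomp (Sp M a) (S a) (X a)"
    "\<forall>a\<in>?C. \<forall>b\<in>?C. a \<le> b \<longrightarrow> Tr M a b ` X a \<subseteq> X b" by (elim exE conjE)
  note X = X0(1)[rule_format] X0(2)[rule_format]
  define R where "R a = (if a \<in> ?C then X a else {0})" for a
  let ?M1 = "M\<lparr>Sp := S\<rparr>" and ?M2 = "M\<lparr>Sp := R\<rparr>"
  have dd: "direct_decomp (Sp M a) (S a) (R a)" if "a \<in> P" for a
  proof (cases "a \<in> ?C")
    case False
    then show ?thesis using off[OF that False] by (auto simp: S_def R_def direct_decomp_def)
  qed (use X(1) in \<open>auto simp: R_def\<close>)
  have out: "Tr M a b x = 0" if "a \<in> P" "b \<in> P" "a \<le> b" "x \<in> Sp M a" "a \<notin> ?C \<or> b \<notin> ?C" for a b x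
  proof (cases "a \<in> ?C")
    case True
    then show ?thesis using pers_module_map(1)[OF M that(1-4)] off[OF that(2)] that(5) by simp
  next
    case False
    then show ?thesis using off[OF that(1) False] that(4) pers_module_map_zero[OF M that(1-3)] by simp
  qed
  have M1: "pers_submodule scale P ?M1 M"
  proof (rule pers_submodule_update[OF M Ssub])
    show "Tr M a b x \<in> S b" if ab: "a \<in> P" "b \<in> P" "a \<le> b" and x: "x \<in> S a" for a b x
    proof (cases "a \<in> ?C \<and> b \<in> ?C")
      case True
      then show ?thesis using Smap[of a b] ab(3) x by blast
    next
      case False
      then show ?thesis using out[OF ab, of x] Ssub[OF ab(1)] Ssub[OF ab(2)] x subspace_0 by auto
    qed
  qed
  have M2: "pers_submodule scale P ?M2 M"
  proof (rule pers_submodule_update[OF M])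
    show R: "subspace (R a) \<and> R a \<subseteq> Sp M a" if "a \<in> P" for a
      using direct_decompD(2,5)[OF dd[OF that]] by blast
    show "Tr M a b x \<in> R b" if ab: "a \<in> P" "b \<in> P" "a \<le> b" and x: "x \<in> R a" for a b x
    proof (cases "a \<in> ?C \<and> b \<in> ?C")
      case True
      then show ?thesis using X(2)[of a b] ab(3) x by (auto simp: R_def)
    next
      case False
      then show ?thesis using out[OF ab, of x] R[OF ab(1)] R[OF ab(2)] x subspace_0 by auto
    qed
  qed
  have sum: "internal_direct_sum scale P M [?M1, ?M2]"
    using internal_direct_sum_pair[OF M] M1 M2 dd by simp
  have pm: "pers_module scale P ?M1" "pers_module scale P ?M2"
    using pers_submoduleD(1) M1 M2 by blast+

  have "\<exists>G. barcode_basis P ?M2 G \<and> bars P G \<subseteq> {chain_interval C s t | s t. s \<in> C \<and> t \<in> C \<and> s \<le> t}"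
  proof (rule insert.IH[OF _ pm(2)])
    have "R p = {0}" using direct_decomp_self[of "Sp M p" "R p"] dd[OF p] Sp by simp
    then show "Sp ?M2 a = {0}" if "a \<in> P" "a \<notin> C" for a
      using that by (cases "a = p") (auto simp: R_def)
  qed (use CP in auto)
  then obtain G2 where G2: "barcode_basis P ?M2 G2"
    "bars P G2 \<subseteq> {chain_interval C s t | s t. s \<in> C \<and> t \<in> C \<and> s \<le> t}" by (elim exE conjE)

  let ?K = "\<lambda>a. {x \<in> Sp M p. Tr M p a x = 0}"
  have Ksub: "subspace (?K a)" if "a \<in> ?C" for a
    using pers_module_kernel_subspace[OF M p _ le[OF that]] that CP by blast
  define \<F> where "\<F> = ?K ` ?C"
  have K: "F \<subseteq> Sp M p \<and> subspace F" if "F \<in> \<F>" for F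
    using that Ksub unfolding \<F>_def by (elim imageE) auto
  have "\<forall>F\<in>\<F>. \<forall>H\<in>\<F>. F \<subseteq> H \<or> H \<subseteq> F"
    unfolding \<F>_def by (rule kernels_form_chain[OF M p CP le chain])
  then have 1: "\<forall>F\<in>insert (Sp M p) \<F>. \<forall>H\<in>insert (Sp M p) \<F>. F \<subseteq> H \<or> H \<subseteq> F"
    using K by simp
  have 2: "\<forall>F\<in>insert (Sp M p) \<F> \<union> {Sp M p}. subspace F \<and> F \<subseteq> Sp M p"
    using K sub[OF p] by simp
  have 3: "finite (insert (Sp M p) \<F>)" using finC by (simp add: \<F>_def)
  obtain T where T: "independent T" "span T = Sp M p"
    and "\<forall>F\<in>insert (Sp M p) \<F> \<union> {Sp M p}. F \<subseteq> span (T \<inter> F)"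
    by (rule basis_adapted_to_two_chains[OF 3 1 _ _ 2]) simp_all
  then have TK: "?K a \<subseteq> span (T \<inter> ?K a)" if "a \<in> ?C" for a
    using imageI[OF that, of ?K] unfolding \<F>_def[symmetric] by simp
  have TM: "T \<subseteq> Sp M p" using T(2) span_superset by blast
  let ?G1 = "(\<lambda>x a. if p \<le> a then Tr ?M1 p a x else 0) ` T"
  have G1: "barcode_basis P ?M1 ?G1"
  proof (rule barcode_basis_of_generated[OF pm(1) p _ _ T(1)])
    show "span T = Sp ?M1 p" using T(2) Sp by simp
    show "Sp ?M1 a = Tr ?M1 p a ` Sp ?M1 p" if "a \<in> P" "p \<le> a" for a
    proof (cases "a \<in> ?C")
      case True
      then show ?thesis using SC Sp by simp
    next
      case False
      have "Tr M p a ` Sp M p = {0}"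
        using out[OF p that] False subspace_0[OF sub[OF p]] by force
      moreover have "S a = {0}" using False by (simp add: S_def)
      ultimately show ?thesis using Sp by simp
    qed
    show "Sp ?M1 a = {0}" if "a \<in> P" "\<not> p \<le> a" for a
      using le that by (auto simp: S_def)
    show "{x \<in> Sp ?M1 p. Tr ?M1 p a x = 0} \<subseteq> span (T \<inter> {x \<in> Sp ?M1 p. Tr ?M1 p a x = 0})"
      if a: "a \<in> P" "p \<le> a" for a
    proof (cases "a \<in> ?C")
      case True
      then show ?thesis using TK Sp by simp
    next
      case False
      then have "?K a = Sp M p" using out[OF p a] by blast
      moreover have "T \<inter> Sp M p = T" using TM by blast
      ultimately show ?thesis using Sp T(2) by simp
    qed
  qed
  have bars1: "bars P ?G1 \<subseteq> {chain_interval ?C s t | s t. s \<in> ?C \<and> t \<in> ?C \<and> s \<le> t}"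
  proof clarify
    fix x assume x: "x \<in> T"
    let ?D = "{a \<in> P. (if p \<le> a then Tr ?M1 p a x else 0) \<noteq> 0}"
    have xM: "x \<in> Sp M p" "x \<noteq> 0" using x TM T(1) dependent_zero by auto
    have D: "a \<in> ?D \<longleftrightarrow> a \<in> ?C \<and> Tr M p a x \<noteq> 0" for a
      using out[OF p _ _ xM(1), of a] le[of a] CP by auto
    have "p \<in> ?D" using D[of p] xM pers_module_id[OF M p] by simp
    obtain t where "t \<in> ?D" "?D = chain_interval ?C p t"
    proof (rule chain_interval_if_down_closed[OF finC chain _ _ _ le])
      show "?D \<subseteq> ?C" using D by blast
      show "?D \<noteq> {}" using \<open>p \<in> ?D\<close> by blast
      show "a \<in> ?D" if "a \<in> ?C" "b \<in> ?D" "a \<le> b" for a b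
      proof -
        have P: "a \<in> P" "b \<in> P" using that CP by auto
        have "Tr M a b (Tr M p a x) \<noteq> 0"
          using pers_module_comp[OF M p P le[OF that(1)] that(3) xM(1)] that(2) D by simp
        then show ?thesis using pers_module_map_zero[OF M P that(3)] D that(1) by force
      qed
    qed
    then show "\<exists>s t. ?D = chain_interval ?C s t \<and> s \<in> ?C \<and> t \<in> ?C \<and> s \<le> t"
      using D le by blast
  qed
  have smaller: "chain_interval C s t = chain_interval ?C s t" if "s \<in> C" for s t
    using insert.hyps(3) that by (force simp: chain_interval_def)
  have "{chain_interval C s t | s t. s \<in> C \<and> t \<in> C \<and> s \<le> t} \<subseteq>
      {chain_interval ?C s t | s t. s \<in> ?C \<and> t \<in> ?C \<and> s \<le> t}"
  proof clarify
    fix s t assume st: "s \<in> C" "t \<in> C" "s \<le> t"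
    show "\<exists>s' t'. chain_interval C s t = chain_interval ?C s' t' \<and> s' \<in> ?C \<and> t' \<in> ?C \<and> s' \<le> t'"
      using smaller[OF st(1)] st by blast
  qed
  with G2(2) have bars2: "bars P G2 \<subseteq> {chain_interval ?C s t | s t. s \<in> ?C \<and> t \<in> ?C \<and> s \<le> t}"
    by (rule subset_trans)
  have "barcode_basis P M (?G1 \<union> G2)"
    using barcode_basis_sum[OF M sum G1 G2(1)] .
  moreover have "bars P (?G1 \<union> G2) \<subseteq> {chain_interval ?C s t | s t. s \<in> ?C \<and> t \<in> ?C \<and> s \<le> t}"
    unfolding image_Un using bars1 bars2 by (rule Un_least)
  ultimately show ?case by blast
qed

end

section \<open>The bipath poset\<close>

lemma bipath_Bot_le [simp]: "Bot \<le> a" and bipath_le_Top [simp]: "a \<le> Top"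
  and bipath_le_Bot [simp]: "a \<le> Bot \<longleftrightarrow> a = Bot" and bipath_Top_le [simp]: "Top \<le> a \<longleftrightarrow> a = Top"
  by (cases a; simp)+

lemma upper_path_chain: "finite (upper_path n)" "\<forall>x\<in>upper_path n. \<forall>y\<in>upper_path n. x \<le> y \<or> y \<le> x"
  and lower_path_chain: "finite (lower_path m)" "\<forall>x\<in>lower_path m. \<forall>y\<in>lower_path m. x \<le> y \<or> y \<le> x"
  by (auto simp: upper_path_def lower_path_def)

lemma paths_in_bipath_poset:
  "upper_path n \<subseteq> bipath_poset n m" "lower_path m \<subseteq> bipath_poset n m"
  "Bot \<in> upper_path n" "Top \<in> upper_path n" "Bot \<in> lower_path m" "Top \<in> lower_path m"
  "Bot \<in> bipath_poset n m" "Top \<in> bipath_poset n m"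
  by (auto simp: bipath_poset_def upper_path_def lower_path_def)

lemma upper_Int_lower: "upper_path n \<inter> lower_path m = {Bot, Top}"
  by (auto simp: upper_path_def lower_path_def)

lemma comparable_in_common_path:
  assumes "a \<in> bipath_poset n m" "b \<in> bipath_poset n m" "a \<le> b"
  obtains "a \<in> upper_path n" "b \<in> upper_path n" | "a \<in> lower_path m" "b \<in> lower_path m"
  using assms by (auto simp: bipath_poset_def upper_path_def lower_path_def)

lemma L_interval_if_down_closed:
  assumes D: "D \<subseteq> bipath_poset n m" "Bot \<in> D" "Top \<notin> D"
    and down: "\<And>x y. x \<in> bipath_poset n m \<Longrightarrow> y \<in> D \<Longrightarrow> x \<le> y \<Longrightarrow> x \<in> D"
  shows "D \<in> L_intervals n m"
proof -
  obtain t where t: "t \<in> D \<inter> upper_path n" "D \<inter> upper_path n = chain_interval (upper_path n) Bot t"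
    by (rule chain_interval_if_down_closed[OF upper_path_chain, of "D \<inter> upper_path n" n Bot, OF Int_lower2 _ _ bipath_Bot_le])
      (use D(2) paths_in_bipath_poset(3) down[OF subsetD[OF paths_in_bipath_poset(1)]] in blast)+
  obtain s where s: "s \<in> D \<inter> lower_path m" "D \<inter> lower_path m = chain_interval (lower_path m) Bot s"
    by (rule chain_interval_if_down_closed[OF lower_path_chain, of "D \<inter> lower_path m" m Bot, OF Int_lower2 _ _ bipath_Bot_le])
      (use D(2) paths_in_bipath_poset(5) down[OF subsetD[OF paths_in_bipath_poset(2)]] in blast)+
  have "D = (D \<inter> upper_path n) \<union> (D \<inter> lower_path m)"
    using D(1) by (auto simp: bipath_poset_def)
  then have "D = chain_interval (upper_path n) Bot t \<union> chain_interval (lower_path m) Bot s"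
    using s(2) t(2) by simp
  then show ?thesis
    unfolding L_intervals_def using s(1) t(1) D(3) by blast
qed

lemma R_interval_if_up_closed:
  assumes D: "D \<subseteq> bipath_poset n m" "Top \<in> D" "Bot \<notin> D"
    and up: "\<And>x y. x \<in> bipath_poset n m \<Longrightarrow> y \<in> D \<Longrightarrow> y \<le> x \<Longrightarrow> x \<in> D"
  shows "D \<in> R_intervals n m"
proof -
  obtain s where s: "s \<in> D \<inter> upper_path n" "D \<inter> upper_path n = chain_interval (upper_path n) s Top"
    by (rule chain_interval_if_up_closed[OF upper_path_chain, of "D \<inter> upper_path n" n Top, OF Int_lower2 _ _ bipath_le_Top])
      (use D(2) paths_in_bipath_poset(4) up[OF subsetD[OF paths_in_bipath_poset(1)]] in blast)+
  obtain t where t: "t \<in> D \<inter> lower_path m" "D \<inter> lower_path m = chain_interval (lower_path m) t Top"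
    by (rule chain_interval_if_up_closed[OF lower_path_chain, of "D \<inter> lower_path m" m Top, OF Int_lower2 _ _ bipath_le_Top])
      (use D(2) paths_in_bipath_poset(6) up[OF subsetD[OF paths_in_bipath_poset(2)]] in blast)+
  have "D = (D \<inter> upper_path n) \<union> (D \<inter> lower_path m)"
    using D(1) by (auto simp: bipath_poset_def)
  then have "D = chain_interval (upper_path n) s Top \<union> chain_interval (lower_path m) t Top"
    using s(2) t(2) by simp
  then show ?thesis
    unfolding R_intervals_def using s(1) t(1) D(3) by blast
qed

context ambient_space
begin

section \<open>The steps of the construction\<close>

text \<open>A submodule that is everything at $\hat 0$ and zero at $\hat 1$ leaves no choice for the complement at these two points, and
they are the only ones that the two paths share.\<close>
lemma bipath_complement:
  assumes M: "pers_module scale (bipath_poset n m) M" and S: "pers_submodule scale (bipath_poset n m) (M\<lparr>Sp := S\<rparr>) M"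
    and ends: "S Bot = Sp M Bot" "S Top = {0}"
    and XU: "\<exists>X. (\<forall>a\<in>upper_path n. direct_decomp (Sp M a) (S a) (X a)) \<and>
      (\<forall>a\<in>upper_path n. \<forall>b\<in>upper_path n. a \<le> b \<longrightarrow> Tr M a b ` X a \<subseteq> X b)"
    and XD: "\<exists>X. (\<forall>a\<in>lower_path m. direct_decomp (Sp M a) (S a) (X a)) \<and>
      (\<forall>a\<in>lower_path m. \<forall>b\<in>lower_path m. a \<le> b \<longrightarrow> Tr M a b ` X a \<subseteq> X b)"
  shows "\<exists>X. internal_direct_sum scale (bipath_poset n m) M [M\<lparr>Sp := S\<rparr>, X]"
proof -
  let ?B = "bipath_poset n m" and ?U = "upper_path n" and ?D = "lower_path m"
  obtain X1 where X1: "\<forall>a\<in>?U. direct_decomp (Sp M a) (S a) (X1 a)"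
    "\<forall>a\<in>?U. \<forall>b\<in>?U. a \<le> b \<longrightarrow> Tr M a b ` X1 a \<subseteq> X1 b" using XU by (elim exE conjE)
  obtain X2 where X2: "\<forall>a\<in>?D. direct_decomp (Sp M a) (S a) (X2 a)"
    "\<forall>a\<in>?D. \<forall>b\<in>?D. a \<le> b \<longrightarrow> Tr M a b ` X2 a \<subseteq> X2 b" using XD by (elim exE conjE)
  \<comment> \<open>At \<open>Bot\<close> and \<open>Top\<close> the complement is forced, so the two choices agree there.\<close>
  have "X1 Bot = {0}" "X2 Bot = {0}"
    using bspec[OF X1(1) paths_in_bipath_poset(3)] bspec[OF X2(1) paths_in_bipath_poset(5)]
    unfolding ends by (simp_all add: direct_decomp_self)
  moreover have "X1 Top = Sp M Top" "X2 Top = Sp M Top"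
    using bspec[OF X1(1) paths_in_bipath_poset(4)] bspec[OF X2(1) paths_in_bipath_poset(6)]
    unfolding ends by (simp_all add: direct_decomp_zero)
  ultimately have agree: "X1 a = X2 a" if "a \<in> ?U" "a \<in> ?D" for a
    using that IntI[of a ?U ?D] upper_Int_lower[of n m] by auto
  define X where "X a = (if a \<in> ?U then X1 a else X2 a)" for a
  have XU: "X a = X1 a" if "a \<in> ?U" for a using that by (simp add: X_def)
  have XD: "X a = X2 a" if "a \<in> ?D" for a using that agree by (simp add: X_def)
  have dd: "direct_decomp (Sp M a) (S a) (X a)" if "a \<in> ?B" for a
    using that X1(1) X2(1) XU XD by (auto simp: bipath_poset_def)
  have "pers_submodule scale ?B (M\<lparr>Sp := X\<rparr>) M"
  proof (rule pers_submodule_update[OF M])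
    show "subspace (X a) \<and> X a \<subseteq> Sp M a" if "a \<in> ?B" for a
      using direct_decompD(2,5)[OF dd[OF that]] by blast
    fix a b x assume ab: "a \<in> ?B" "b \<in> ?B" "a \<le> b" and x: "x \<in> X a"
    from ab show "Tr M a b x \<in> X b"
    proof (cases rule: comparable_in_common_path)
      case 1
      then have "Tr M a b ` X1 a \<subseteq> X1 b" using X1(2) ab(3) by blast
      then show ?thesis using 1 XU x by auto
    next
      case 2
      then have "Tr M a b ` X2 a \<subseteq> X2 b" using X2(2) ab(3) by blast
      then show ?thesis using 2 XD x by auto
    qed
  qed
  then show ?thesis
    using internal_direct_sum_pair[OF M] S dd by (intro exI[of _ "M\<lparr>Sp := X\<rparr>"]) simp
qed

text \<open>The structure map restricts to a bijection from a complement of its kernel onto its image.\<close>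
lemma linear_section_exists:
  assumes M: "pers_module scale P M" "a \<in> P" "b \<in> P" "a \<le> b"
  shows "\<exists>\<iota>. lin_map scale scale (Tr M a b ` Sp M a) (Sp M a) \<iota> \<and>
    (\<forall>x\<in>Tr M a b ` Sp M a. Tr M a b (\<iota> x) = x)"
proof -
  let ?f = "Tr M a b" and ?K = "{x \<in> Sp M a. Tr M a b x = 0}"
  have sub: "subspace (Sp M a)" by (rule pers_module_space(1)[OF M(1,2)])
  obtain C where C: "direct_decomp (Sp M a) ?K C"
    using complement_exists[OF sub pers_module_kernel_subspace[OF M]] by auto
  note Cs = direct_decompD(2)[OF C] direct_decompD(5)[OF C]
  have inj: "x = y" if "x \<in> C" "y \<in> C" "?f x = ?f y" for x y
  proof -
    have xy: "x \<in> Sp M a" "y \<in> Sp M a" using that Cs(2) by auto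
    then have "?f (x - y) = 0" using pers_module_map_diff[OF M, of x y] that(3) by simp
    then have "x - y \<in> ?K" using subspace_diff[OF sub xy] by simp
    then have "x - y = 0" using direct_decompD(6)[OF C] subspace_diff[OF Cs(1) that(1,2)] by blast
    then show ?thesis by simp
  qed
  have "\<exists>y\<in>C. ?f y = x" if "x \<in> ?f ` Sp M a" for x
  proof -
    obtain v where v: "v \<in> Sp M a" "x = ?f v" using \<open>x \<in> _\<close> by blast
    obtain k y where "k \<in> ?K" "y \<in> C" "v = k + y" using direct_decompD(7)[OF C v(1)] by blast
    then have "k \<in> Sp M a" "?f k = 0" "y \<in> Sp M a" "v = k + y" "y \<in> C" using Cs(2) by auto
    then have "?f v = ?f y" using pers_module_map(2)[OF M, of k y] by simp
    then show ?thesis using v(2) \<open>y \<in> C\<close> by (intro bexI[of _ y]) simp_all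
  qed
  then obtain \<iota> where \<iota>: "\<forall>x\<in>?f ` Sp M a. \<iota> x \<in> C \<and> ?f (\<iota> x) = x" by metis
  then have \<iota>C: "\<iota> x \<in> C" "\<iota> x \<in> Sp M a" "?f (\<iota> x) = x" if "x \<in> ?f ` Sp M a" for x
    using that Cs(2) by blast+
  have N: "subspace (?f ` Sp M a)" using pers_module_image_subspace[OF M sub] by simp
  have "lin_map scale scale (?f ` Sp M a) (Sp M a) \<iota>"
    unfolding lin_map_def
  proof (intro conjI ballI allI)
    fix x assume x: "x \<in> ?f ` Sp M a"
    show "\<iota> x \<in> Sp M a" by (rule \<iota>C(2)[OF x])
    show "\<iota> (x + y) = \<iota> x + \<iota> y" if y: "y \<in> ?f ` Sp M a" for y
      using inj[OF \<iota>C(1)[OF subspace_add[OF N x y]] subspace_add[OF Cs(1) \<iota>C(1)[OF x] \<iota>C(1)[OF y]]]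
        \<iota>C(3)[OF subspace_add[OF N x y]] \<iota>C(3)[OF x] \<iota>C(3)[OF y]
        pers_module_map(2)[OF M \<iota>C(2)[OF x] \<iota>C(2)[OF y]] by simp
    show "\<iota> (c *s x) = c *s \<iota> x" for c
      using inj[OF \<iota>C(1)[OF subspace_scale[OF N x]] subspace_scale[OF Cs(1) \<iota>C(1)[OF x]], of c]
        \<iota>C(3)[OF subspace_scale[OF N x]] \<iota>C(3)[OF x]
        pers_module_map(3)[OF M \<iota>C(2)[OF x]] by simp
  qed
  then show ?thesis using \<iota>C(3) by blast
qed

lemma section_image_subspace:
  assumes N: "subspace N" and \<iota>: "lin_map scale scale N E \<iota>"
  shows "subspace (\<iota> ` N)"
proof (rule subspaceI)
  have add: "\<iota> (x + y) = \<iota> x + \<iota> y" and scl: "\<iota> (c *s x) = c *s \<iota> x" if "x \<in> N" "y \<in> N" for x y c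
    using \<iota> that by (auto simp: lin_map_def)
  have "\<iota> 0 = 0" using scl[OF subspace_0[OF N] subspace_0[OF N], of 0] by simp
  then show "0 \<in> \<iota> ` N" using subspace_0[OF N] by force
  show "x + y \<in> \<iota> ` N" if xy: "x \<in> \<iota> ` N" "y \<in> \<iota> ` N" for x y
  proof -
    obtain x' y' where "x' \<in> N" "y' \<in> N" "x = \<iota> x'" "y = \<iota> y'" using xy by blast
    then show ?thesis using add[of x' y'] subspace_add[OF N, of x' y'] by (metis imageI)
  qed
  show "c *s x \<in> \<iota> ` N" if x: "x \<in> \<iota> ` N" for x c
  proof -
    obtain x' where "x' \<in> N" "x = \<iota> x'" using x by blast
    then show ?thesis using scl[of x' x' c] subspace_scale[OF N, of x' c] by (metis imageI)
  qed
qed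

text \<open>Following a vector of \<open>Y\<close> on to \<open>q\<close> recovers the element of \<open>N\<close> that it comes from. So the preimages of a
complement \<open>C\<close> of \<open>N\<close> in the space at \<open>q\<close> form a complement of \<open>Y\<close>, and all bars of \<open>Y\<close> are equal to \<open>P\<close>.\<close>
lemma full_support_summand:
  fixes P :: "'b::order set" and M :: "('b, 'v) pmod" and \<iota> :: "'v \<Rightarrow> 'v"
  assumes M: "pers_module scale P M" and p: "p \<in> P" "\<And>a. a \<in> P \<Longrightarrow> p \<le> a"
    and q: "q \<in> P" "\<And>a. a \<in> P \<Longrightarrow> a \<le> q"
  defines "N \<equiv> Tr M p q ` Sp M p"
  assumes \<iota>: "lin_map scale scale N (Sp M p) \<iota>" "\<forall>x\<in>N. Tr M p q (\<iota> x) = x"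
  defines "Y \<equiv> M\<lparr>Sp := (\<lambda>a. Tr M p a ` \<iota> ` N)\<rparr>"
  shows "\<exists>W. internal_direct_sum scale P M [Y, W]"
    and "internal_direct_sum scale P M [Y, W] \<Longrightarrow> w \<in> Sp W p \<Longrightarrow> Tr W p q w = 0"
    and "sum_of_interval_modules scale P {P} Y"
proof -
  have pq: "p \<le> q" using p q by blast
  have sub: "subspace (Sp M a)" if "a \<in> P" for a using pers_module_space(1)[OF M that] .
  have N: "subspace N" unfolding N_def using pers_module_image_subspace[OF M p(1) q(1) pq sub[OF p(1)]] by simp
  have \<iota>s: "subspace (\<iota> ` N)" by (rule section_image_subspace[OF N \<iota>(1)])
  have \<iota>N: "\<iota> ` N \<subseteq> Sp M p" using \<iota>(1) by (auto simp: lin_map_def)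
  have \<iota>q: "Tr M p q (\<iota> x) = x" if "x \<in> N" for x using \<iota>(2) that by blast
  have Nq: "N \<subseteq> Sp M q" unfolding N_def using pers_module_map(1)[OF M p(1) q(1) pq] by blast
  \<comment> \<open>In particular the structure map from \<open>p\<close> to any \<open>a\<close> is injective on \<open>\<iota> ` N\<close>.\<close>
  have toq: "Tr M a q (Tr M p a x) = Tr M p q x" if "a \<in> P" "x \<in> Sp M p" for a x
    using pers_module_comp[OF M p(1) that(1) q(1) p(2) q(2) that(2)] that(1) by blast
  have Ysub: "pers_submodule scale P Y M"
    unfolding Y_def
  proof (rule pers_submodule_update[OF M])
    show "subspace (Tr M p a ` \<iota> ` N) \<and> Tr M p a ` \<iota> ` N \<subseteq> Sp M a" if "a \<in> P" for a
      using pers_module_image_subspace[OF M p(1) that p(2)[OF that] \<iota>s \<iota>N]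
        pers_module_map(1)[OF M p(1) that p(2)[OF that]] \<iota>N by blast
    show "Tr M a b x \<in> Tr M p b ` \<iota> ` N" if "a \<in> P" "b \<in> P" "a \<le> b" "x \<in> Tr M p a ` \<iota> ` N" for a b x
      using that(4) pers_module_comp[OF M p(1) that(1,2) p(2)[OF that(1)] that(3)] \<iota>N by force
  qed
  obtain C where C: "direct_decomp (Sp M q) N C" using complement_exists[OF sub[OF q(1)] N Nq] .
  let ?W = "M\<lparr>Sp := (\<lambda>a. {v \<in> Sp M a. Tr M a q v \<in> C})\<rparr>"
  have Wsub: "pers_submodule scale P ?W M"
  proof (rule pers_submodule_update[OF M])
    show "subspace {v \<in> Sp M a. Tr M a q v \<in> C} \<and> {v \<in> Sp M a. Tr M a q v \<in> C} \<subseteq> Sp M a" if "a \<in> P" for a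
      using pers_module_preimage_subspace[OF M that q(1) q(2)[OF that] direct_decompD(2)[OF C]] by blast
    show "Tr M a b x \<in> {v \<in> Sp M b. Tr M b q v \<in> C}"
      if "a \<in> P" "b \<in> P" "a \<le> b" "x \<in> {v \<in> Sp M a. Tr M a q v \<in> C}" for a b x
      using that(4) pers_module_map(1)[OF M that(1-3)]
        pers_module_comp[OF M that(1,2) q(1) that(3) q(2)[OF that(2)]] by simp
  qed
  have "direct_decomp (Sp M a) (Sp Y a) (Sp ?W a)" if a: "a \<in> P" for a
  proof (rule direct_decompI)
    show "subspace (Sp Y a)" "subspace (Sp ?W a)" "subspace (Sp M a)" "Sp Y a \<subseteq> Sp M a" "Sp ?W a \<subseteq> Sp M a"
      using pers_submoduleD(1,2)[OF Ysub] pers_submoduleD(1,2)[OF Wsub] pers_module_space(1)[OF _ a] M a by blast+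
    show "x = 0" if x: "x \<in> Sp Y a" "x \<in> Sp ?W a" for x
    proof -
      obtain y where y: "y \<in> N" "x = Tr M p a (\<iota> y)" using x(1) by (auto simp: Y_def)
      then have "Tr M a q x = y" using toq[OF a, of "\<iota> y"] \<iota>q[of y] \<iota>N by auto
      then have "y = 0" using x(2) y(1) direct_decompD(6)[OF C] by auto
      then have "\<iota> y = 0" using \<iota>(1) y(1) unfolding lin_map_def by (metis scale_zero_left)
      then show ?thesis using y(2) pers_module_map_zero[OF M p(1) a p(2)[OF a]] by simp
    qed
    show "\<exists>y\<in>Sp Y a. \<exists>w\<in>Sp ?W a. v = y + w" if v: "v \<in> Sp M a" for v
    proof -
      obtain y c where y: "y \<in> N" "c \<in> C" "Tr M a q v = y + c"
        using direct_decompD(7)[OF C pers_module_map(1)[OF M a q(1) q(2)[OF a] v]] by blast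
      let ?y = "Tr M p a (\<iota> y)"
      have \<iota>y: "\<iota> y \<in> Sp M p" using \<iota>N y(1) by blast
      have yM: "?y \<in> Sp M a" using pers_module_map(1)[OF M p(1) a p(2)[OF a] \<iota>y] .
      have "Tr M a q (v - ?y) = c"
        using pers_module_map_diff[OF M a q(1) q(2)[OF a] v yM] toq[OF a \<iota>y] \<iota>q[OF y(1)] y(3) by simp
      then have "v - ?y \<in> Sp ?W a" using y(2) subspace_diff[OF sub[OF a] v yM] by simp
      moreover have "?y \<in> Sp Y a" using y(1) by (simp add: Y_def)
      moreover have "v = ?y + (v - ?y)" by simp
      ultimately show ?thesis by blast
    qed
  qed
  then show "\<exists>W. internal_direct_sum scale P M [Y, W]"
    using internal_direct_sum_pair[OF M] Ysub Wsub by blast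
  show "Tr W p q w = 0" if W: "internal_direct_sum scale P M [Y, W]" "w \<in> Sp W p"
  proof -
    have Ws: "pers_submodule scale P W M" and dd: "direct_decomp (Sp M q) (Sp Y q) (Sp W q)"
      using W(1) internal_direct_sum_pair[OF M] q(1) by auto
    have wM: "w \<in> Sp M p" using pers_submoduleD(2)[OF Ws p(1)] W(2) by blast
    have "Tr W p q w \<in> Sp W q" using pers_module_map(1)[OF pers_submoduleD(1)[OF Ws] p(1) q(1) pq W(2)] .
    moreover have eq: "Tr W p q w = Tr M p q w" using pers_submoduleD(3)[OF Ws p(1) q(1) pq W(2)] .
    moreover have "Tr M p q w \<in> N" using wM by (simp add: N_def)
    then have "Tr M p q w \<in> Tr M p q ` \<iota> ` N" using \<iota>q by (metis imageI)
    then have "Tr M p q w \<in> Sp Y q" by (simp add: Y_def)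
    ultimately show ?thesis using direct_decompD(6)[OF dd] by simp
  qed
  show "sum_of_interval_modules scale P {P} Y"
  proof -
    have Y: "pers_module scale P Y" by (rule pers_submoduleD(1)[OF Ysub])
    have Yp: "Sp Y p = \<iota> ` N" using pers_module_id[OF M p(1)] \<iota>N by (force simp: Y_def)
    have TrY: "Tr Y = Tr M" and SpY: "Sp Y a = Tr M p a ` \<iota> ` N" for a by (simp_all add: Y_def)
    have ker: "x = 0" if a: "a \<in> P" and x: "x \<in> Sp Y p" "Tr Y p a x = 0" for a x
    proof -
      obtain y where y: "y \<in> N" "x = \<iota> y" using x(1) Yp by blast
      have "Tr M a q (Tr M p a x) = y" using toq[OF a, of x] \<iota>q y \<iota>N by auto
      then have "y = 0" using x(2) pers_module_map_zero[OF M a q(1) q(2)[OF a]] by (simp add: TrY)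
      then show ?thesis using \<iota>(1) y unfolding lin_map_def by (metis scale_zero_left)
    qed
    obtain T where T: "T \<subseteq> Sp Y p" "independent T" "Sp Y p \<subseteq> span T"
      using maximal_independent_subset by blast
    have spT: "span T = Sp Y p"
      using span_subspace[OF T(1,3) pers_module_space(1)[OF Y p(1)]] .
    let ?G = "(\<lambda>x a. if p \<le> a then Tr Y p a x else 0) ` T"
    have "barcode_basis P Y ?G"
    proof (rule barcode_basis_of_generated[OF Y p(1) _ _ T(2) spT])
      show "Sp Y a = Tr Y p a ` Sp Y p" if "a \<in> P" for a
        using Yp SpY[of a] TrY by simp
      show "{x \<in> Sp Y p. Tr Y p a x = 0} \<subseteq> span (T \<inter> {x \<in> Sp Y p. Tr Y p a x = 0})" if "a \<in> P" for a
        using ker[OF that] span_zero by blast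
    qed (use p(2) in blast)
    moreover have "bars P ?G \<subseteq> {P}"
    proof clarify
      fix x assume x: "x \<in> T"
      then have "x \<noteq> 0" using T(2) dependent_zero by blast
      then show "{a \<in> P. (if p \<le> a then Tr Y p a x else 0) \<noteq> 0} = P"
        using ker T(1) x p(2) by auto
    qed
    ultimately show ?thesis by (rule sum_of_interval_modules_if_barcode_basis[OF Y])
  qed
qed

text \<open>The basis of $W(\hat 0)$ is adapted to the kernels along both paths. As \<open>W'\<close> vanishes at $\hat 1$, the
kernel there is all of $W(\hat 0)$; so each bar contains $\hat 0$, is closed downwards and misses $\hat 1$.\<close>
lemma bottom_generated_summand:
  fixes W :: "(bipath, 'v) pmod"
  assumes W: "pers_module scale (bipath_poset n m) W" and zero: "\<And>w. w \<in> Sp W Bot \<Longrightarrow> Tr W Bot Top w = 0"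
  defines "W' \<equiv> W\<lparr>Sp := (\<lambda>a. Tr W Bot a ` Sp W Bot)\<rparr>"
  shows "\<exists>X. internal_direct_sum scale (bipath_poset n m) W [W', X]"
    and "internal_direct_sum scale (bipath_poset n m) W [W', X] \<Longrightarrow> Sp X Bot = {0}"
    and "sum_of_interval_modules scale (bipath_poset n m) (L_intervals n m) W'"
proof -
  let ?B = "bipath_poset n m"
  note ends = paths_in_bipath_poset(7,8)[of n m]
  have sub: "subspace (Sp W a)" if "a \<in> ?B" for a using pers_module_space(1)[OF W that] .
  define S where "S a = Tr W Bot a ` Sp W Bot" for a
  have W'S: "W' = W\<lparr>Sp := S\<rparr>" by (simp add: W'_def S_def[abs_def])
  have SBot: "S Bot = Sp W Bot" unfolding S_def using pers_module_id[OF W ends(1)] by simp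
  have STop: "S Top = {0}" unfolding S_def using zero subspace_0[OF sub[OF ends(1)]] by force
  have S: "subspace (S a) \<and> S a \<subseteq> Sp W a" if "a \<in> ?B" for a
    unfolding S_def using pers_module_image_subspace[OF W ends(1) that bipath_Bot_le sub[OF ends(1)] subset_refl]
      pers_module_map(1)[OF W ends(1) that bipath_Bot_le] by blast
  have Smap: "Tr W a b ` S a = S b" if "a \<in> ?B" "b \<in> ?B" "a \<le> b" for a b
  proof -
    have "Tr W a b (Tr W Bot a x) = Tr W Bot b x" if "x \<in> Sp W Bot" for x
      using pers_module_comp[OF W ends(1) \<open>a \<in> ?B\<close> \<open>b \<in> ?B\<close> bipath_Bot_le \<open>a \<le> b\<close> that] .
    then show ?thesis by (simp add: S_def image_image)
  qed
  have W'sub: "pers_submodule scale ?B W' W"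
    unfolding W'S by (rule pers_submodule_update[OF W S]) (use Smap in blast)+
  have compl: "\<exists>X. (\<forall>a\<in>C. direct_decomp (Sp W a) (S a) (X a)) \<and>
      (\<forall>a\<in>C. \<forall>b\<in>C. a \<le> b \<longrightarrow> Tr W a b ` X a \<subseteq> X b)"
    if "finite C" "\<forall>x\<in>C. \<forall>y\<in>C. x \<le> y \<or> y \<le> x" "C \<subseteq> ?B" for C
  proof (rule chain_complement_of_surjective[OF W that])
    show "subspace (S a) \<and> S a \<subseteq> Sp W a" if "a \<in> C" for a using S that \<open>C \<subseteq> ?B\<close> by blast
    show "S b \<subseteq> Tr W a b ` S a" if "a \<in> C" "b \<in> C" "a \<le> b" for a b
      using Smap[of a b] that \<open>C \<subseteq> ?B\<close> by auto
  qed
  show "\<exists>X. internal_direct_sum scale ?B W [W', X]"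
    unfolding W'S
    by (rule bipath_complement[OF W _ SBot STop compl[OF upper_path_chain] compl[OF lower_path_chain]])
      (use W'sub W'S paths_in_bipath_poset in auto)
  show "Sp X Bot = {0}" if "internal_direct_sum scale ?B W [W', X]"
  proof -
    have "direct_decomp (Sp W Bot) (Sp W' Bot) (Sp X Bot)"
      using that internal_direct_sum_pair[OF W] ends(1) by blast
    then show ?thesis using direct_decomp_self by (simp add: W'S SBot)
  qed
  have pm: "pers_module scale ?B W'" by (rule pers_submoduleD(1)[OF W'sub])
  have SpW': "Sp W' a = Tr W' Bot a ` Sp W' Bot" for a
    using SBot by (simp add: W'S) (simp add: S_def)
  let ?K = "\<lambda>a. {x \<in> Sp W' Bot. Tr W' Bot a x = 0}"
  have Ktop: "?K Top = Sp W' Bot" using zero SBot by (auto simp: W'S)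
  define \<F> where "\<F> = ?K ` upper_path n"
  define \<G> where "\<G> = ?K ` lower_path m"
  have F: "\<forall>F\<in>\<F>. \<forall>H\<in>\<F>. F \<subseteq> H \<or> H \<subseteq> F" unfolding \<F>_def
    by (rule kernels_form_chain[OF pm ends(1) paths_in_bipath_poset(1) bipath_Bot_le upper_path_chain(2)])
  have G: "\<forall>F\<in>\<G>. \<forall>H\<in>\<G>. F \<subseteq> H \<or> H \<subseteq> F" unfolding \<G>_def
    by (rule kernels_form_chain[OF pm ends(1) paths_in_bipath_poset(2) bipath_Bot_le lower_path_chain(2)])
  have fin: "finite \<F>" "finite \<G>" using upper_path_chain(1) lower_path_chain(1) by (simp_all add: \<F>_def \<G>_def)
  have FG: "\<F> \<union> \<G> = ?K ` ?B" by (simp add: \<F>_def \<G>_def bipath_poset_def image_Un)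
  have Ksub: "\<forall>F\<in>\<F> \<union> \<G>. subspace F \<and> F \<subseteq> Sp W' Bot"
    unfolding FG using pers_module_kernel_subspace[OF pm ends(1) _ bipath_Bot_le] by blast
  have E: "Sp W' Bot \<in> \<F>" "Sp W' Bot \<in> \<G>"
    unfolding \<F>_def \<G>_def using imageI[of Top _ ?K, unfolded Ktop] paths_in_bipath_poset(4,6) by blast+
  obtain T where T: "independent T" "span T = Sp W' Bot" "\<forall>F\<in>\<F> \<union> \<G>. F \<subseteq> span (T \<inter> F)"
    by (rule basis_adapted_to_two_chains[OF fin(1) F fin(2) G Ksub E])
  have TW: "T \<subseteq> Sp W' Bot" using T(2) span_superset by blast
  let ?G = "(\<lambda>x a. if Bot \<le> a then Tr W' Bot a x else 0) ` T"
  have "barcode_basis ?B W' ?G"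
  proof (rule barcode_basis_of_generated[OF pm ends(1) SpW' _ T(1,2)])
    show "?K a \<subseteq> span (T \<inter> ?K a)" if "a \<in> ?B" for a
      using T(3) imageI[OF that, of ?K] unfolding FG by blast
  qed simp
  moreover have "bars ?B ?G \<subseteq> L_intervals n m"
  proof clarify
    fix x assume x: "x \<in> T"
    have xW: "x \<in> Sp W' Bot" "x \<noteq> 0" using x TW T(1) dependent_zero by auto
    let ?D = "{a \<in> ?B. (if Bot \<le> a then Tr W' Bot a x else 0) \<noteq> 0}"
    have D: "?D = {a \<in> ?B. Tr W' Bot a x \<noteq> 0}" by simp
    have "{a \<in> ?B. Tr W' Bot a x \<noteq> 0} \<in> L_intervals n m"
    proof (rule L_interval_if_down_closed)
      show "Bot \<in> {a \<in> ?B. Tr W' Bot a x \<noteq> 0}" using ends(1) xW pers_module_id[OF pm] by simp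
      show "Top \<notin> {a \<in> ?B. Tr W' Bot a x \<noteq> 0}" using Ktop xW(1) by blast
      show "a \<in> {a \<in> ?B. Tr W' Bot a x \<noteq> 0}"
        if a: "a \<in> ?B" and b: "b \<in> {a \<in> ?B. Tr W' Bot a x \<noteq> 0}" and "a \<le> b" for a b
      proof -
        have bB: "b \<in> ?B" using b by simp
        have "Tr W' a b (Tr W' Bot a x) = Tr W' Bot b x"
          by (rule pers_module_comp[OF pm ends(1) a bB bipath_Bot_le \<open>a \<le> b\<close> xW(1)])
        then have "Tr W' Bot a x \<noteq> 0" using b pers_module_map_zero[OF pm a bB \<open>a \<le> b\<close>] by auto
        then show ?thesis using a by simp
      qed
    qed simp
    then show "?D \<in> L_intervals n m" unfolding D .
  qed
  ultimately show "sum_of_interval_modules scale ?B (L_intervals n m) W'"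
    by (rule sum_of_interval_modules_if_barcode_basis[OF pm])
qed

text \<open>Dually, a complement \<open>W''\<close> of the kernels has injective structure maps into $\hat 1$, and the basis
of $W''(\hat 1)$ is adapted to the images along both paths.\<close>
lemma top_cogenerated_summand:
  fixes X :: "(bipath, 'v) pmod"
  assumes X: "pers_module scale (bipath_poset n m) X" and Bot: "Sp X Bot = {0}"
  defines "Z \<equiv> X\<lparr>Sp := (\<lambda>a. {x \<in> Sp X a. Tr X a Top x = 0})\<rparr>"
  shows "\<exists>W''. internal_direct_sum scale (bipath_poset n m) X [W'', Z]"
    and "Sp Z Bot = {0}" "Sp Z Top = {0}"
    and "internal_direct_sum scale (bipath_poset n m) X [W'', Z] \<Longrightarrow>
      sum_of_interval_modules scale (bipath_poset n m) (R_intervals n m) W''"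
proof -
  let ?B = "bipath_poset n m"
  note ends = paths_in_bipath_poset(7,8)[of n m]
  have sub: "subspace (Sp X a)" if "a \<in> ?B" for a using pers_module_space(1)[OF X that] .
  define S where "S a = {x \<in> Sp X a. Tr X a Top x = 0}" for a
  have ZS: "Z = X\<lparr>Sp := S\<rparr>" by (simp add: Z_def S_def[abs_def])
  have SBot: "S Bot = Sp X Bot" unfolding S_def Bot using pers_module_map_zero[OF X ends bipath_Bot_le] by auto
  have STop: "S Top = {0}" unfolding S_def using pers_module_id[OF X ends(2)] subspace_0[OF sub[OF ends(2)]] by auto
  show "Sp Z Bot = {0}" "Sp Z Top = {0}" using SBot STop Bot by (simp_all add: ZS)
  have S: "subspace (S a) \<and> S a \<subseteq> Sp X a" if "a \<in> ?B" for a
    unfolding S_def using pers_module_kernel_subspace[OF X that ends(2) bipath_le_Top] by blast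
  have Smap: "Tr X a b x \<in> S b \<longleftrightarrow> x \<in> S a" if "a \<in> ?B" "b \<in> ?B" "a \<le> b" "x \<in> Sp X a" for a b x
    using that(4) pers_module_map(1)[OF X that] pers_module_comp[OF X that(1,2) ends(2) that(3) bipath_le_Top that(4)]
    by (simp add: S_def)
  have Zsub: "pers_submodule scale ?B Z X"
    unfolding ZS by (rule pers_submodule_update[OF X S]) (use Smap S in blast)+
  have compl: "\<exists>Y. (\<forall>a\<in>C. direct_decomp (Sp X a) (S a) (Y a)) \<and>
      (\<forall>a\<in>C. \<forall>b\<in>C. a \<le> b \<longrightarrow> Tr X a b ` Y a \<subseteq> Y b)"
    if "finite C" "\<forall>x\<in>C. \<forall>y\<in>C. x \<le> y \<or> y \<le> x" "C \<subseteq> ?B" for C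
  proof (rule chain_complement_of_saturated[OF X that])
    show "subspace (S a) \<and> S a \<subseteq> Sp X a" if "a \<in> C" for a using S that \<open>C \<subseteq> ?B\<close> by blast
    show "x \<in> S a" if "a \<in> C" "b \<in> C" "a \<le> b" "x \<in> Sp X a" "Tr X a b x \<in> S b" for a b x
      using Smap[of a b x] that \<open>C \<subseteq> ?B\<close> by auto
  qed
  have "\<exists>Y. internal_direct_sum scale ?B X [Z, Y]"
    unfolding ZS
    by (rule bipath_complement[OF X _ SBot STop compl[OF upper_path_chain] compl[OF lower_path_chain]])
      (use Zsub ZS paths_in_bipath_poset in auto)
  then show "\<exists>W''. internal_direct_sum scale ?B X [W'', Z]"
    unfolding internal_direct_sum_pair[OF X] using direct_decomp_commute by blast
  show "sum_of_interval_modules scale ?B (R_intervals n m) W''"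
    if W'': "internal_direct_sum scale ?B X [W'', Z]"
  proof -
    have Wsub: "pers_submodule scale ?B W'' X"
      and dd: "\<And>a. a \<in> ?B \<Longrightarrow> direct_decomp (Sp X a) (Sp W'' a) (Sp Z a)"
      using W'' internal_direct_sum_pair[OF X] by auto
    have pm: "pers_module scale ?B W''" by (rule pers_submoduleD(1)[OF Wsub])
    have inj: "x = 0" if a: "a \<in> ?B" and x: "x \<in> Sp W'' a" "Tr W'' a Top x = 0" for a x
    proof -
      have xX: "x \<in> Sp X a" using pers_submoduleD(2)[OF Wsub a] x(1) by blast
      have "Tr X a Top x = 0" using pers_submoduleD(3)[OF Wsub a ends(2) bipath_le_Top x(1)] x(2) by simp
      then have "x \<in> Sp Z a" using xX by (simp add: Z_def)
      then show ?thesis using direct_decompD(6)[OF dd[OF a] x(1)] by blast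
    qed
    let ?I = "\<lambda>a. Tr W'' a Top ` Sp W'' a"
    have Itop: "?I Top = Sp W'' Top" using pers_module_id[OF pm ends(2)] by simp
    have WBot: "Sp W'' Bot = {0}"
      using pers_submoduleD(2)[OF Wsub ends(1)] Bot subspace_0[OF pers_module_space(1)[OF pm ends(1)]] by blast
    define \<F> where "\<F> = ?I ` upper_path n"
    define \<G> where "\<G> = ?I ` lower_path m"
    have F: "\<forall>F\<in>\<F>. \<forall>H\<in>\<F>. F \<subseteq> H \<or> H \<subseteq> F" unfolding \<F>_def
      by (rule images_form_chain[OF pm ends(2) paths_in_bipath_poset(1) bipath_le_Top upper_path_chain(2)])
    have G: "\<forall>F\<in>\<G>. \<forall>H\<in>\<G>. F \<subseteq> H \<or> H \<subseteq> F" unfolding \<G>_def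
      by (rule images_form_chain[OF pm ends(2) paths_in_bipath_poset(2) bipath_le_Top lower_path_chain(2)])
    have fin: "finite \<F>" "finite \<G>" using upper_path_chain(1) lower_path_chain(1) by (simp_all add: \<F>_def \<G>_def)
    have FG: "\<F> \<union> \<G> = ?I ` ?B" by (simp add: \<F>_def \<G>_def bipath_poset_def image_Un)
    have "subspace (?I a) \<and> ?I a \<subseteq> Sp W'' Top" if "a \<in> ?B" for a
      using pers_module_image_subspace[OF pm that ends(2) bipath_le_Top pers_module_space(1)[OF pm that] subset_refl]
        pers_module_map(1)[OF pm that ends(2) bipath_le_Top] by blast
    then have Isub: "\<forall>F\<in>\<F> \<union> \<G>. subspace F \<and> F \<subseteq> Sp W'' Top"
      unfolding FG by simp
    have E: "Sp W'' Top \<in> \<F>" "Sp W'' Top \<in> \<G>"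
      unfolding \<F>_def \<G>_def using imageI[of Top _ ?I, unfolded Itop] paths_in_bipath_poset(4,6) by blast+
    obtain T where T: "independent T" "span T = Sp W'' Top" "\<forall>F\<in>\<F> \<union> \<G>. F \<subseteq> span (T \<inter> F)"
      by (rule basis_adapted_to_two_chains[OF fin(1) F fin(2) G Isub E])
    have TW: "T \<subseteq> Sp W'' Top" using T(2) span_superset by blast
    have adapted: "?I a \<subseteq> span (T \<inter> ?I a)" if "a \<in> ?B" for a
      using T(3) imageI[OF that, of ?I] unfolding FG by blast
    obtain G where G: "barcode_basis ?B W'' G" "bars ?B G = (\<lambda>x. {a \<in> ?B. x \<in> ?I a}) ` T"
      by (rule barcode_basis_of_cogenerated[OF pm ends(2) bipath_le_Top inj T(1,2) adapted])
    have "{a \<in> ?B. x \<in> ?I a} \<in> R_intervals n m" if x: "x \<in> T" for x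
    proof (rule R_interval_if_up_closed)
      have xW: "x \<in> Sp W'' Top" "x \<noteq> 0" using x TW T(1) dependent_zero by auto
      show "Top \<in> {a \<in> ?B. x \<in> ?I a}" using ends(2) xW(1) Itop by simp
      show "Bot \<notin> {a \<in> ?B. x \<in> ?I a}"
        using WBot xW(2) pers_module_map_zero[OF pm ends bipath_Bot_le] by simp
      show "a \<in> {a \<in> ?B. x \<in> ?I a}" if a: "a \<in> ?B" and b: "b \<in> {a \<in> ?B. x \<in> ?I a}" and le: "b \<le> a" for a b
      proof -
        obtain y where y: "b \<in> ?B" "y \<in> Sp W'' b" "x = Tr W'' b Top y" using b by blast
        have "Tr W'' a Top (Tr W'' b a y) = x"
          using pers_module_comp[OF pm y(1) a ends(2) le bipath_le_Top y(2)] y(3) by simp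
        then show ?thesis using pers_module_map(1)[OF pm y(1) a le y(2)] a by blast
      qed
    qed simp
    then have "bars ?B G \<subseteq> R_intervals n m" unfolding G(2) by (rule image_subsetI)
    then show ?thesis by (rule sum_of_interval_modules_if_barcode_basis[OF pm G(1)])
  qed
qed

text \<open>No structure map of \<open>Z\<close> leads from one path to the other, because comparable elements lie on a
common path; the two restrictions overlap only at $\hat 0$ and $\hat 1$, where \<open>Z\<close> vanishes.\<close>
lemma interior_summands:
  fixes Z :: "(bipath, 'v) pmod"
  assumes Z: "pers_module scale (bipath_poset n m) Z" and ends: "Sp Z Bot = {0}" "Sp Z Top = {0}"
  defines "Z' \<equiv> extend_by_zero (upper_path n) Z" and "Z'' \<equiv> extend_by_zero (lower_path m) Z"
  shows "internal_direct_sum scale (bipath_poset n m) Z [Z', Z'']"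
    and "sum_of_interval_modules scale (bipath_poset n m) (U_intervals n) Z'"
    and "sum_of_interval_modules scale (bipath_poset n m) (D_intervals m) Z''"
proof -
  let ?B = "bipath_poset n m"
  have sub: "subspace (Sp Z a)" if "a \<in> ?B" for a using pers_module_space(1)[OF Z that] .
  have ext: "pers_submodule scale ?B (extend_by_zero C Z) Z"
    if C: "C \<in> {upper_path n, lower_path m}" for C
  proof -
    let ?E = "extend_by_zero C Z"
    define S where "S a = (if a \<in> C then Sp Z a else {0})" for a
    have Tr: "Tr ?E a b x = Tr Z a b x" if ab: "a \<in> ?B" "b \<in> ?B" "a \<le> b" and x: "x \<in> S a" for a b x
    proof (cases "a \<in> C \<and> b \<in> C")
      case False
      have "x = 0"
      proof (cases "a \<in> C")
        case True
        then have b: "b \<notin> C" using False by simp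
        have "a \<in> upper_path n \<inter> lower_path m"
          using ab
        proof (cases rule: comparable_in_common_path)
          case 1
          then have "C = lower_path m" using C b by auto
          then show ?thesis using 1(1) True by simp
        next
          case 2
          then have "C = upper_path n" using C b by auto
          then show ?thesis using 2(1) True by simp
        qed
        then have "a = Bot \<or> a = Top" unfolding upper_Int_lower by simp
        moreover have "b \<noteq> Top" using b C paths_in_bipath_poset(4,6) by auto
        ultimately have "a = Bot" using ab(3) by auto
        then show ?thesis using x ends(1) True by (simp add: S_def)
      qed (use x in \<open>simp add: S_def\<close>)
      then show ?thesis using False pers_module_map_zero[OF Z ab] by (auto simp: extend_by_zero_def)
    qed (simp add: extend_by_zero_def)
    have S: "subspace (S a) \<and> S a \<subseteq> Sp Z a" if "a \<in> ?B" for a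
      using sub[OF that] subspace_0[OF sub[OF that]] by (simp add: S_def)
    have ES: "Sp ?E = S" by (simp add: extend_by_zero_def S_def[abs_def])
    have Smap: "Tr Z a b x \<in> S b" if ab: "a \<in> ?B" "b \<in> ?B" "a \<le> b" and x: "x \<in> S a" for a b x
    proof (cases "b \<in> C")
      case True
      then show ?thesis using pers_module_map(1)[OF Z ab, of x] S[OF ab(1)] x by (auto simp: S_def)
    next
      case False
      then have "Tr ?E a b x = 0" by (simp add: extend_by_zero_def)
      then show ?thesis using Tr[OF ab x] False by (simp add: S_def)
    qed
    have N: "pers_module scale ?B (Z\<lparr>Sp := S\<rparr>)"
      by (rule pers_submoduleD(1)[OF pers_submodule_update[OF Z S Smap]])
    have "pers_module scale ?B ?E"
      unfolding pers_module_def lin_map_def ES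
    proof (intro conjI ballI allI impI)
      fix a assume a: "a \<in> ?B"
      show "\<exists>S'. finite S' \<and> S a = span S'" using pers_module_space(2)[OF N a] by simp
      show "Tr ?E a a x = x" if x: "x \<in> S a" for x
        using pers_module_id[OF N a, of x] Tr[OF a a order_refl x] x by simp
      fix b assume b: "b \<in> ?B"
      show "Tr ?E a b x \<in> S b" if "a \<le> b" "x \<in> S a" for x
        using Smap[OF a b that] Tr[OF a b that] by simp
      show "Tr ?E a b (x + y) = Tr ?E a b x + Tr ?E a b y" if "a \<le> b" "x \<in> S a" "y \<in> S a" for x y
        using pers_module_map(2)[OF N a b that(1), of x y] Tr[OF a b that(1)] that(2,3) S[OF a] subspace_add
        by simp
      show "Tr ?E a b (c *s x) = c *s Tr ?E a b x" if "a \<le> b" "x \<in> S a" for c x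
        using pers_module_map(3)[OF N a b that(1), of x c] Tr[OF a b that(1)] that(2) S[OF a] subspace_scale
        by simp
      show "Tr ?E b c (Tr ?E a b x) = Tr ?E a c x" if c: "c \<in> ?B" and le: "a \<le> b \<and> b \<le> c" and x: "x \<in> S a" for c x
      proof -
        have le: "a \<le> b" "b \<le> c" "a \<le> c" using le by auto
        show ?thesis
          using pers_module_comp[OF N a b c le(1,2), of x] x Tr[OF a b le(1) x] Tr[OF a c le(3) x]
            Tr[OF b c le(2) Smap[OF a b le(1) x]] by simp
      qed
    qed
    then show ?thesis
      using S Tr by (simp add: pers_submodule_def ES)
  qed
  have Z': "pers_submodule scale ?B Z' Z" and Z'': "pers_submodule scale ?B Z'' Z"
    unfolding Z'_def Z''_def by (rule ext, simp)+
  have "direct_decomp (Sp Z a) (Sp Z' a) (Sp Z'' a)" if a: "a \<in> ?B" for a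
  proof -
    have zero: "direct_decomp E E {0}" if "subspace E" for E
      using that by (intro direct_decompI) (auto simp: subspace_0)
    consider "a \<in> {Bot, Top}" | "a \<in> upper_path n" "a \<notin> lower_path m" | "a \<in> lower_path m" "a \<notin> upper_path n"
      using a upper_Int_lower[of n m] by (auto simp: bipath_poset_def)
    then show ?thesis
    proof cases
      case 1
      then have "Sp Z a = {0}" "Sp Z' a = {0}" "Sp Z'' a = {0}"
        using ends by (auto simp: Z'_def Z''_def extend_by_zero_def)
      then show ?thesis using zero[of "{0}"] by simp
    next
      case 2
      then show ?thesis using zero[OF sub[OF a]] by (simp add: Z'_def Z''_def extend_by_zero_def)
    next
      case 3
      then show ?thesis using direct_decomp_commute[OF zero[OF sub[OF a]]]
        by (simp add: Z'_def Z''_def extend_by_zero_def)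
    qed
  qed
  then show "internal_direct_sum scale ?B Z [Z', Z'']"
    using internal_direct_sum_pair[OF Z] Z' Z'' by blast
  have summand: "sum_of_interval_modules scale ?B
      {chain_interval C s t | s t. s \<in> C - {Bot, Top} \<and> t \<in> C - {Bot, Top} \<and> s \<le> t} (extend_by_zero C Z)"
    if C: "C \<in> {upper_path n, lower_path m}" for C
  proof -
    let ?E = "extend_by_zero C Z" and ?C = "C - {Bot, Top}"
    have pm: "pers_module scale ?B ?E" by (rule pers_submoduleD(1)[OF ext[OF C]])
    have fin: "finite ?C" and chain: "\<forall>x\<in>?C. \<forall>y\<in>?C. x \<le> y \<or> y \<le> x" and sub: "?C \<subseteq> ?B"
      using C upper_path_chain[of n] lower_path_chain[of m] by (auto simp: bipath_poset_def)
    have "Sp ?E a = {0}" if "a \<in> ?B" "a \<notin> ?C" for a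
      using that ends by (auto simp: extend_by_zero_def)
    from barcode_basis_of_chain_supported[OF fin chain sub pm this]
    obtain G where G: "barcode_basis ?B ?E G"
      "bars ?B G \<subseteq> {chain_interval ?C s t | s t. s \<in> ?C \<and> t \<in> ?C \<and> s \<le> t}" by blast
    have eq: "chain_interval ?C s t = chain_interval C s t" if "s \<in> ?C" "t \<in> ?C" for s t
    proof -
      have "x \<noteq> Bot" "x \<noteq> Top" if "s \<le> x" "x \<le> t" for x
        using that \<open>s \<in> ?C\<close> \<open>t \<in> ?C\<close> by auto
      then show ?thesis unfolding chain_interval_def by blast
    qed
    have "{chain_interval ?C s t | s t. s \<in> ?C \<and> t \<in> ?C \<and> s \<le> t} \<subseteq>
        {chain_interval C s t | s t. s \<in> ?C \<and> t \<in> ?C \<and> s \<le> t}" (is "?L \<subseteq> ?R")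
    proof (intro subsetI, elim CollectE exE conjE)
      fix K s t assume "K = chain_interval ?C s t" "s \<in> ?C" "t \<in> ?C" "s \<le> t"
      then show "K \<in> ?R" using eq[of s t] by blast
    qed
    with G(2) have "bars ?B G \<subseteq> ?R" by (rule subset_trans)
    then show ?thesis by (rule sum_of_interval_modules_if_barcode_basis[OF pm G(1)])
  qed
  show "sum_of_interval_modules scale ?B (U_intervals n) Z'"
    unfolding U_intervals_def Z'_def by (rule summand) simp
  show "sum_of_interval_modules scale ?B (D_intervals m) Z''"
    unfolding D_intervals_def Z''_def by (rule summand) simp
qed

end

theorem proposition3p4:
  fixes scale :: "'k::field \<Rightarrow> 'v::ab_group_add \<Rightarrow> 'v"
    and n m :: nat
    and V :: "(bipath, 'v) pmod"
  assumes "vector_space scale"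
    and "n > 0" and "m > 0"
    and "pers_module scale (bipath_poset n m) V"
  shows "(\<exists>\<iota> Y W W' X W'' Z Z' Z''. bipath_construction scale n m V \<iota> Y W W' X W'' Z Z' Z'') \<and>
    (\<forall>\<iota> Y W W' X W'' Z Z' Z''. bipath_construction scale n m V \<iota> Y W W' X W'' Z Z' Z'' \<longrightarrow>
       internal_direct_sum scale (bipath_poset n m) V [Y, W', W'', Z', Z''] \<and>
       sum_of_interval_modules scale (bipath_poset n m) {bipath_poset n m} Y \<and>
       sum_of_interval_modules scale (bipath_poset n m) (L_intervals n m) W' \<and>
       sum_of_interval_modules scale (bipath_poset n m) (R_intervals n m) W'' \<and>
       sum_of_interval_modules scale (bipath_poset n m) (U_intervals n) Z' \<and>
       sum_of_interval_modules scale (bipath_poset n m) (D_intervals m) Z'')"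
proof -
  interpret ambient_space scale by (rule ambient_space.intro) fact
  let ?B = "bipath_poset n m"
  note V = assms(4) and ends = paths_in_bipath_poset(7,8)[of n m]
  let ?N = "Tr V Bot Top ` Sp V Bot"
  let ?Y = "\<lambda>\<iota>. V\<lparr>Sp := (\<lambda>a. Tr V Bot a ` \<iota> ` ?N)\<rparr>"
    and ?W' = "\<lambda>W :: (bipath, 'v) pmod. W\<lparr>Sp := (\<lambda>a. Tr W Bot a ` Sp W Bot)\<rparr>"
    and ?Z = "\<lambda>X :: (bipath, 'v) pmod. X\<lparr>Sp := (\<lambda>a. {x \<in> Sp X a. Tr X a Top x = 0})\<rparr>"
  have second: "pers_module scale ?B M2" if "pers_module scale ?B M" "internal_direct_sum scale ?B M [M1, M2]"
    for M M1 M2 :: "(bipath, 'v) pmod"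
    using that internal_direct_sum_pair pers_submoduleD(1) by blast
  note full = full_support_summand[OF V ends(1) bipath_Bot_le ends(2) bipath_le_Top]

  have "\<exists>\<iota> Y W W' X W'' Z Z' Z''. bipath_construction scale n m V \<iota> Y W W' X W'' Z Z' Z''"
  proof -
    obtain \<iota> where \<iota>: "lin_map scale scale ?N (Sp V Bot) \<iota>" "\<forall>x\<in>?N. Tr V Bot Top (\<iota> x) = x"
      using linear_section_exists[OF V ends bipath_Bot_le] by (elim exE conjE)
    obtain W where W: "internal_direct_sum scale ?B V [?Y \<iota>, W]"
      using full(1)[OF \<iota>] by (elim exE)
    note pW = second[OF V W]
    have zero: "Tr W Bot Top w = 0" if "w \<in> Sp W Bot" for w
      using full(2)[OF \<iota> W that] .
    have "\<exists>X. internal_direct_sum scale ?B W [?W' W, X]"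
      by (rule bottom_generated_summand(1)[OF pW zero])
    then obtain X where X: "internal_direct_sum scale ?B W [?W' W, X]"
      by (elim exE)
    have "Sp X Bot = {0}" by (rule bottom_generated_summand(2)[OF pW zero X])
    then obtain W'' where W'': "internal_direct_sum scale ?B X [W'', ?Z X]"
      using top_cogenerated_summand(1)[OF second[OF pW X]] by blast
    have "bipath_construction scale n m V \<iota> (?Y \<iota>) W (?W' W) X W'' (?Z X)
        (extend_by_zero (upper_path n) (?Z X)) (extend_by_zero (lower_path m) (?Z X))"
      unfolding bipath_construction_def Let_def using \<iota> W X W'' by (intro conjI) (assumption | rule refl)+
    then show ?thesis by (intro exI)
  qed
  moreover
  have "internal_direct_sum scale ?B V [Y, W', W'', Z', Z''] \<and>
       sum_of_interval_modules scale ?B {?B} Y \<and>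
       sum_of_interval_modules scale ?B (L_intervals n m) W' \<and>
       sum_of_interval_modules scale ?B (R_intervals n m) W'' \<and>
       sum_of_interval_modules scale ?B (U_intervals n) Z' \<and>
       sum_of_interval_modules scale ?B (D_intervals m) Z''"
    if "bipath_construction scale n m V \<iota> Y W W' X W'' Z Z' Z''" for \<iota> Y W W' X W'' Z Z' Z''
  proof -
    have \<iota>: "lin_map scale scale ?N (Sp V Bot) \<iota>" "\<forall>x\<in>?N. Tr V Bot Top (\<iota> x) = x"
      and Y: "Y = ?Y \<iota>" and VW: "internal_direct_sum scale ?B V [Y, W]"
      and W': "W' = ?W' W" and WX: "internal_direct_sum scale ?B W [W', X]"
      and Z: "Z = ?Z X" and XZ: "internal_direct_sum scale ?B X [W'', Z]"
      and Z': "Z' = extend_by_zero (upper_path n) Z" and Z'': "Z'' = extend_by_zero (lower_path m) Z"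
      using that unfolding bipath_construction_def Let_def by blast+
    note pW = second[OF V VW]
    note pX = second[OF pW WX]
    note pZ = second[OF pX XZ]
    have zero: "Tr W Bot Top w = 0" if "w \<in> Sp W Bot" for w
      using full(2)[OF \<iota> VW[unfolded Y] that] .
    have XBot: "Sp X Bot = {0}" by (rule bottom_generated_summand(2)[OF pW zero WX[unfolded W']])
    have Zends: "Sp Z Bot = {0}" "Sp Z Top = {0}"
      unfolding Z using top_cogenerated_summand(2,3)[OF pX XBot] .
    note mid = interior_summands[OF pZ Zends, folded Z' Z'']
    have "internal_direct_sum scale ?B V [Y, W', W'', Z', Z'']"
      using internal_direct_sum_refine[OF V VW internal_direct_sum_refine[OF pW WX
            internal_direct_sum_refine[OF pX XZ mid(1)]]] .
    moreover have "sum_of_interval_modules scale ?B {?B} Y"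
      unfolding Y by (rule full(3)[OF \<iota>])
    moreover have "sum_of_interval_modules scale ?B (L_intervals n m) W'"
      unfolding W' by (rule bottom_generated_summand(3)[OF pW zero])
    moreover have "sum_of_interval_modules scale ?B (R_intervals n m) W''"
      by (rule top_cogenerated_summand(4)[OF pX XBot XZ[unfolded Z]])
    ultimately show ?thesis using mid(2,3) by blast
  qed
  ultimately show ?thesis by blast
qed

end
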